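(* Let $A\in\mathbb{R}^{n\times n}$ and $c\in\mathbb{R}^{1\times n}$ be such that $(A,c)$ is observable, and let $k\in\{1,\dots,n\}$. For $r\in\{1,\dots,k\}$ and $\beta\in\mathcal{I}_{n,k}$ define $P_\beta := I_{\{1,\dots,n\},\beta}\in\mathbb{R}^{n\times k}$ (the columns of the identity matrix $I\in\mathbb{R}^{n\times n}$ with indices in $\beta$), $\tilde A_r := A_{[r]}$, $\tilde c_r := \left(\mathcal{O}^r\right)_{[r]}$ and $$\tilde b_{k,r,\beta} := \begin{pmatrix}\left(A^{k-r}\left(\mathcal{O}^n\right)^{-1}\begin{pmatrix}0\\ I_{n-k+r}\end{pmatrix}\right)_{[r]} & 0\end{pmatrix}\left(\mathcal{O}^nP_\beta\right)_{[k]},$$ where the zero block has $\binom{n}{k}-\binom{n-k+r}{r}$ columns. (a) For all $r\in\{1,\dots,k\}$, $\beta\in\mathcal{I}_{n,k}$, all integers $N\ge1$ and $t\in\{1,\dots,N-k+1\}$, with $\alpha=\{1,\dots,k-r\}\cup\{k-r+t,\dots,k+t-1\}$, it holds that $$\det\left(\mathcal{O}^N_{\alpha,\beta}\right)=\tilde c_r\tilde A_r^{t-1}\tilde b_{k,r,\beta}.$$ (b) The observability operator $\mathcal{O}$ of $(A,c)$ is strictly $(k-1)$-variation bounding if and only if the systems $(\tilde A_r,\tilde b_{k,r,\beta},\tilde c_r)$, for all $r\in\{1,\dots,k\}$ and all $\beta=\{1,\dots,k-\bar r\}\cup\{\bar t,\dots,\bar t+\bar r-1\}$ with $\bar r\in\{1,\dots,k\}$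 and $\bar t\in\{k-\bar r+1,\dots,n-\bar r+1\}$, are either all strictly externally positive or all strictly externally negative.
   Context: Observability: for $A\in\mathbb{R}^{n\times n}$, $c\in\mathbb{R}^{1\times n}$, the observability operator $\mathcal{O}=\mathcal{O}(A,c):\mathbb{R}^n\to\mathbb{R}^{\mathbb{Z}_{\ge 0}}$ is $(\mathcal{O}x_0)(t):=cA^tx_0$, $t\ge 0$. For $t\ge1$, $\mathcal{O}^t\in\mathbb{R}^{t\times n}$ is the matrix with rows $c, cA,\dots,cA^{t-1}$ (in this order). $(A,c)$ is observable if $\mathcal{O}^n$ is invertible. Index sets and submatrices: $\mathcal{I}_{n,k}$ is the set of $k$-element subsets of $\{1,\dots,n\}$, listed increasingly. $X_{\alpha,\beta}$ is the submatrix of $X$ with rows $\alpha$ and columns $\beta$. A set $\{i,\dots,j\}$ with $i>j$ is empty. Compound matrices: for $X\in\mathbb{R}^{p\times q}$ and $1\le r\le\min\{p,q\}$, $X_{[r]}\in\mathbb{R}^{\binom{p}{r}\times\binom{q}{r}}$ is the $r$-th multiplicative compound matrix: its entries are the $r\times r$ minors $\det X_{I,J}$, with $I\in\mathcal{I}_{p,r}$, $J\in\mathcal{I}_{q,r}$ ordered lexicographically. External positivity: a triple $(\tilde A,\tilde b,\tilde c)$ (square matrix, column vector, row vector of compatible sizes) is strictly externally positive (negative) if $\tilde c\tilde A^{t-1}\tilde b>0$ ($<0$) for all integers $t\ge1$. Variation: for a real vector or sequence $u\neq0$, $S^-(u)$ is the number of sign changes in $u$ after deleting all zero entries, and $S^-(0):=-1$.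 $S^+(u)$ is the maximal number of sign changes obtainable after replacing each zero entry of $u$ by a nonzero real number. A linear map $u\mapsto Xu$ is strictly $k$-variation bounding ($k\in\mathbb{Z}_{\ge0}$) if $S^+(Xu)\le k$ for all $u\ne0$ with $S^-(u)\le k$. *)

theory Defs
  imports
    "Jordan_Normal_Form.Gauss_Jordan_Elimination"
    "Jordan_Normal_Form.Determinant"
    "Jordan_Normal_Form.DL_Submatrix"
    "HOL-Library.List_Lexorder"
    "HOL-Library.Extended_Real"
begin

text \<open>
  Conventions. Matrices are those of \<^theory>\<open>Jordan_Normal_Form.Matrix\<close>, whose rows and columns
  are numbered from 0. Accordingly the index set \<open>{1, ..., n}\<close> becomes \<open>{..<n}\<close>, and a set of indices
  \<open>{i, ..., j}\<close> becomes \<open>{i-1..<j}\<close>. Time shifts and orders of minors are not indices and keep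
  their values. Row vectors, column vectors and scalars occurring in matrix products are
  \<open>1 \<times> n\<close>, \<open>n \<times> 1\<close> and \<open>1 \<times> 1\<close> matrices.
\<close>

section \<open>Compound matrices\<close>

definition index_sets :: "nat \<Rightarrow> nat \<Rightarrow> nat set set" where
  "index_sets n k = {\<alpha>. \<alpha> \<subseteq> {..<n} \<and> card \<alpha> = k}"

text \<open>
  The outer \<^const>\<open>sorted_list_of_set\<close> sorts lists, using the lexicographic order of
  \<^theory>\<open>HOL-Library.List_Lexorder\<close>; the inner one lists each index set increasingly.
\<close>

definition lex_index_sets :: "nat \<Rightarrow> nat \<Rightarrow> nat set list" where
  "lex_index_sets n k = map set (sorted_list_of_set (sorted_list_of_set ` index_sets n k))"

definition compound :: "nat \<Rightarrow> 'a :: comm_ring_1 mat \<Rightarrow> 'a mat" where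
  "compound r X = mat (length (lex_index_sets (dim_row X) r)) (length (lex_index_sets (dim_col X) r))
     (\<lambda>(i, j). det (submatrix X (lex_index_sets (dim_row X) r ! i) (lex_index_sets (dim_col X) r ! j)))"

lemma finite_index_sets: "finite (index_sets n k)"
  unfolding index_sets_def by (rule finite_subset[of _ "Pow {..<n}"]) auto

lemma length_lex_index_sets: "length (lex_index_sets n k) = n choose k"
proof -
  have "inj_on sorted_list_of_set (index_sets n k)"
    by (rule inj_on_inverseI[where g = set])
      (auto simp: index_sets_def finite_subset[of _ "{..<n}"])
  then have "card (sorted_list_of_set ` index_sets n k) = card (index_sets n k)"
    by (rule card_image)
  then show ?thesis
    by (simp add: lex_index_sets_def index_sets_def n_subsets)
qed

lemma compound_carrier:
  "X \<in> carrier_mat p q \<Longrightarrow> compound r X \<in> carrier_mat (p choose r) (q choose r)"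
  by (simp add: compound_def length_lex_index_sets)

definition append_cols :: "'a :: zero mat \<Rightarrow> 'a mat \<Rightarrow> 'a mat" where
  "append_cols X Y = four_block_mat X Y (0\<^sub>m 0 (dim_col X)) (0\<^sub>m 0 (dim_col Y))"

section \<open>Observability\<close>

definition obs_op :: "real mat \<Rightarrow> real mat \<Rightarrow> real vec \<Rightarrow> nat \<Rightarrow> real" where
  "obs_op A c x t = ((c * A ^\<^sub>m t) *\<^sub>v x) $ 0"

definition obs_mat :: "real mat \<Rightarrow> real mat \<Rightarrow> nat \<Rightarrow> real mat" where
  "obs_mat A c t = mat t (dim_row A) (\<lambda>(i, j). (c * A ^\<^sub>m i) $$ (0, j))"

definition observable :: "real mat \<Rightarrow> real mat \<Rightarrow> bool" where
  "observable A c \<longleftrightarrow> invertible_mat (obs_mat A c (dim_row A))"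

section \<open>Variation\<close>

text \<open>
  A vector or sequence is given by a function \<open>u\<close> together with its set \<open>D\<close> of positions, e.g.
  \<open>{..<n}\<close> or \<^term>\<open>UNIV\<close>. Deleting entries means shrinking \<open>D\<close>. A sign change is a pair of
  neighbouring positions of \<open>D\<close> carrying entries of opposite sign; there may be infinitely many.
\<close>

definition sign_change_pairs :: "nat set \<Rightarrow> (nat \<Rightarrow> real) \<Rightarrow> (nat \<times> nat) set" where
  "sign_change_pairs D u =
     {(i, j). i \<in> D \<and> j \<in> D \<and> i < j \<and> (\<forall>l\<in>D. \<not> (i < l \<and> l < j)) \<and> u i * u j < 0}"

definition sign_changes :: "nat set \<Rightarrow> (nat \<Rightarrow> real) \<Rightarrow> ereal" where
  "sign_changes D u =
     (if finite (sign_change_pairs D u) then ereal (real (card (sign_change_pairs D u))) else \<infinity>)"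

definition S_minus :: "nat set \<Rightarrow> (nat \<Rightarrow> real) \<Rightarrow> ereal" where
  "S_minus D u = (if \<forall>i\<in>D. u i = 0 then - 1 else sign_changes {i \<in> D. u i \<noteq> 0} u)"

definition S_plus :: "nat set \<Rightarrow> (nat \<Rightarrow> real) \<Rightarrow> ereal" where
  "S_plus D u = (SUP v \<in> {v. \<forall>i\<in>D. v i \<noteq> 0 \<and> (u i \<noteq> 0 \<longrightarrow> v i = u i)}. sign_changes D v)"

text \<open>For maps \<open>X\<close> from vectors of length \<open>n\<close> to sequences:\<close>

definition strictly_variation_bounding :: "nat \<Rightarrow> nat \<Rightarrow> (real vec \<Rightarrow> nat \<Rightarrow> real) \<Rightarrow> bool" where
  "strictly_variation_bounding k n X \<longleftrightarrow>
     (\<forall>u \<in> carrier_vec n. u \<noteq> 0\<^sub>v n \<and> S_minus {..<n} (\<lambda>i. u $ i) \<le> ereal (real k)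
        \<longrightarrow> S_plus UNIV (X u) \<le> ereal (real k))"

section \<open>External positivity\<close>

definition strictly_externally_positive :: "real mat \<Rightarrow> real mat \<Rightarrow> real mat \<Rightarrow> bool" where
  "strictly_externally_positive A b c \<longleftrightarrow> (\<forall>t\<ge>1. (c * A ^\<^sub>m (t - 1) * b) $$ (0, 0) > 0)"

definition strictly_externally_negative :: "real mat \<Rightarrow> real mat \<Rightarrow> real mat \<Rightarrow> bool" where
  "strictly_externally_negative A b c \<longleftrightarrow> (\<forall>t\<ge>1. (c * A ^\<^sub>m (t - 1) * b) $$ (0, 0) < 0)"

section \<open>The compound systems\<close>

definition P_mat :: "nat \<Rightarrow> nat set \<Rightarrow> real mat" where
  "P_mat n \<beta> = submatrix (1\<^sub>m n) {..<n} \<beta>"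

definition A_tilde :: "real mat \<Rightarrow> nat \<Rightarrow> real mat" where
  "A_tilde A r = compound r A"

definition c_tilde :: "real mat \<Rightarrow> real mat \<Rightarrow> nat \<Rightarrow> real mat" where
  "c_tilde A c r = compound r (obs_mat A c r)"

text \<open>\<^const>\<open>mat_inverse\<close> returns an option, which is not \<^const>\<open>None\<close> for invertible matrices.\<close>

definition b_tilde :: "real mat \<Rightarrow> real mat \<Rightarrow> nat \<Rightarrow> nat \<Rightarrow> nat set \<Rightarrow> real mat" where
  "b_tilde A c k r \<beta> =
     (let n = dim_row A in
        append_cols
          (compound r (A ^\<^sub>m (k - r) * the (mat_inverse (obs_mat A c n))
             * (0\<^sub>m (k - r) (n - k + r) @\<^sub>r 1\<^sub>m (n - k + r))))
          (0\<^sub>m (n choose r) ((n choose k) - ((n - k + r) choose r)))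
        * compound k (obs_mat A c n * P_mat n \<beta>))"

end

theory Submission
  imports Defs
begin

text \<open>
  Part (a) is the Cauchy-Binet formula. The rows \<open>c A\<^sup>t\<close> are written in the basis formed by the first
  \<open>n\<close> rows of the observability matrix, in which the rows with \<open>t < k - r\<close> are unit vectors. In the
  expansion of a minor whose rows include these, only the \<open>k\<close>-sets containing \<open>{..<k - r}\<close> survive, and
  the coordinate minors reduce to order \<open>r\<close>; they are the entries of the \<open>r\<close>-th compound of
  \<open>\<O>\<^sup>r A\<^bsup>t-1\<^esup> A\<^bsup>k-r\<^esup> (\<O>\<^sup>n)\<^sup>-\<^sup>1 (0, I)\<close>. The sets containing \<open>{..<k - r}\<close> come
  first in the lexicographic order (\<open>lex_index_sets_prefix\<close>), which is why the zero block in
  \<open>b_tilde\<close> cuts off exactly the others, and multiplicativity of compounds (\<open>compound_mult\<close>)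
  turns the sum into the output of the compound system (\<open>compound_system_output\<close>).

  By (a), the systems in part (b) are all strictly positive (negative) if and only if all initial \<open>k\<close>-minors of
  the infinite observability matrix are, that is, those whose row set and column set both consist
  of a segment \<open>{..<p}\<close> and one further block of consecutive indices. Two steps remain.

  First, positivity of the initial minors implies positivity of all \<open>k\<close>-minors. For fixed columns the
  \<open>k\<close>-minors are the Pluecker coordinates of a subspace. The three-term relation
  \<open>\<Delta>\<^sub>a\<^sub>c \<Delta>\<^sub>b\<^sub>d = \<Delta>\<^sub>a\<^sub>b \<Delta>\<^sub>c\<^sub>d + \<Delta>\<^sub>a\<^sub>d \<Delta>\<^sub>b\<^sub>c\<close> propagates positivity from the initial sets to all
  sets (\<open>pluecker_positive\<close>); it is used for the rows and then for the columns.

  Second, a map is strictly \<open>(k - 1)\<close>-variation bounding if and only if all its \<open>k\<close>-minors are nonzero and of the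
  same sign. If they are, a vector with at most \<open>k - 1\<close> sign changes is contracted to \<open>k\<close> blocks of
  constant sign, and \<open>k + 1\<close> weakly alternating entries in its image would contradict the linear relation between
  \<open>k + 1\<close> rows in dimension \<open>k\<close>, whose coefficients are minors
  (\<open>S_plus_bound_if_minors_positive\<close>). Conversely, vanishing minors or minors of opposite signs yield vectors with
  few sign changes, namely kernel vectors and vectors of cofactors, whose images have too many zeros or
  alternate too often (\<open>minor_nonzero\<close>, \<open>minors_same_sign_rows\<close>, \<open>minors_same_sign_cols\<close>).
\<close>

section \<open>Minors of doubly indexed families\<close>

text \<open>
  Rows and columns are addressed by lists instead of sets: lists allow repetitions and arbitrary
  orders, so that the exchange arguments below become statements about \<open>t # I\<close> and about
  permuted lists. The infinite observability matrix is covered because the entries are a function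
  on all of \<open>nat \<times> nat\<close>.
\<close>

definition minor :: "(nat \<Rightarrow> nat \<Rightarrow> 'a :: comm_ring_1) \<Rightarrow> nat list \<Rightarrow> nat list \<Rightarrow> 'a" where
  "minor X I J = det (mat (length I) (length I) (\<lambda>(i, j). X (I ! i) (J ! j)))"

definition del :: "nat \<Rightarrow> 'a list \<Rightarrow> 'a list" where
  "del j xs = take j xs @ drop (Suc j) xs"

lemma length_del [simp]: "j < length xs \<Longrightarrow> length (del j xs) = length xs - 1"
  by (simp add: del_def)

lemma nth_del: "j < length xs \<Longrightarrow> i < length xs - 1 \<Longrightarrow> del j xs ! i = xs ! (if i < j then i else Suc i)"
  by (auto simp: del_def nth_append min_def)

lemma minor_cong:
  assumes "\<And>i j. i \<in> set I \<Longrightarrow> j \<in> set J \<Longrightarrow> X i j = Y i j" and "length I = length J"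
  shows "minor X I J = minor Y I J"
  unfolding minor_def using assms by (intro arg_cong[where f = det] cong_mat) auto

lemma minor_map: "length I = length J \<Longrightarrow> minor X (map f I) (map g J) = minor (\<lambda>i j. X (f i) (g j)) I J"
  unfolding minor_def by (intro arg_cong[where f = det] cong_mat) auto

lemma minor_transpose:
  assumes "length I = length J"
  shows "minor X I J = minor (\<lambda>i j. X j i) J I"
proof -
  let ?A = "mat (length I) (length I) (\<lambda>(i, j). X (I ! i) (J ! j))"
  have "minor (\<lambda>i j. X j i) J I = det (transpose_mat ?A)"
    unfolding minor_def using assms by (intro arg_cong[where f = det] eq_matI) auto
  then show ?thesis
    by (simp add: minor_def det_transpose[of _ "length I"])
qed

lemma minor_laplace_row:
  assumes "length J = Suc (length I)"
  shows "minor X (t # I) J = (\<Sum>j<length J. (-1) ^ j * X t (J ! j) * minor X I (del j J))"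
proof -
  let ?n = "Suc (length I)"
  let ?A = "mat ?n ?n (\<lambda>(i, j). X ((t # I) ! i) (J ! j))"
  have "minor X (t # I) J = (\<Sum>j<?n. ?A $$ (0, j) * cofactor ?A 0 j)"
    unfolding minor_def by (simp add: laplace_expansion_row[of _ ?n 0])
  also have "\<dots> = (\<Sum>j<length J. (-1) ^ j * X t (J ! j) * minor X I (del j J))"
  proof (intro sum.cong)
    fix j assume j: "j \<in> {..<length J}"
    then have j': "j < ?n" using assms by simp
    have "mat_delete ?A 0 j = mat (length I) (length I) (\<lambda>(i, l). X (I ! i) (del j J ! l))"
      using j assms by (intro eq_matI) (auto simp: mat_delete_def nth_del)
    then show "?A $$ (0, j) * cofactor ?A 0 j = (-1) ^ j * X t (J ! j) * minor X I (del j J)"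
      using j' by (simp add: cofactor_def minor_def)
  qed (use assms in auto)
  finally show ?thesis .
qed

lemma minor_not_distinct:
  assumes "\<not> distinct I"
  shows "minor X I J = 0"
proof -
  obtain i j where ij: "i < length I" "j < length I" "i \<noteq> j" "I ! i = I ! j"
    using assms by (auto simp: distinct_conv_nth)
  show ?thesis
    unfolding minor_def
    by (rule det_identical_rows[of _ "length I" i j]) (use ij in \<open>auto intro!: eq_vecI\<close>)
qed

lemma minor_zero_row:
  assumes "t \<in> set I" and "\<And>j. j \<in> set J \<Longrightarrow> X t j = 0" and "length I = length J"
  shows "minor X I J = 0"
proof -
  obtain i where i: "i < length I" "I ! i = t"
    using assms by (auto simp: in_set_conv_nth)
  let ?A = "mat (length I) (length I) (\<lambda>(i, j). X (I ! i) (J ! j))"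
  have "minor X I J = (\<Sum>j<length I. ?A $$ (i, j) * cofactor ?A i j)"
    unfolding minor_def by (rule laplace_expansion_row) (use i in auto)
  also have "\<dots> = 0"
    using i assms by (intro sum.neutral) auto
  finally show ?thesis .
qed

lemma minor_zero_col:
  assumes "t \<in> set J" and "\<And>i. i \<in> set I \<Longrightarrow> X i t = 0" and "length I = length J"
  shows "minor X I J = 0"
  using assms by (subst minor_transpose) (auto intro!: minor_zero_row)

lemma minor_swap:
  assumes "length J = Suc (Suc (length P + length L))"
  shows "minor X (P @ x # y # L) J = - minor X (P @ y # x # L) J"
proof -
  let ?n = "Suc (Suc (length P + length L))"
  let ?A = "mat ?n ?n (\<lambda>(i, j). X ((P @ y # x # L) ! i) (J ! j))"
  have "mat ?n ?n (\<lambda>(i, j). X ((P @ x # y # L) ! i) (J ! j)) = swaprows (length P) (Suc (length P)) ?A"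
    by (intro eq_matI) (auto simp: nth_append nth_Cons split: nat.splits)
  moreover have "det (swaprows (length P) (Suc (length P)) ?A) = - det ?A"
    by (rule det_swaprows[of _ ?n]) auto
  ultimately show ?thesis
    by (simp add: minor_def)
qed

text \<open>
  The sign of the permutation that sorts a list: \<open>-1\<close> to the number of inversions.
\<close>

fun inversion_sign :: "nat list \<Rightarrow> 'a :: comm_ring_1" where
  "inversion_sign [] = 1"
| "inversion_sign (x # xs) = (-1) ^ length (filter (\<lambda>s. s < x) xs) * inversion_sign xs"

text \<open>
  Moving \<open>x\<close> to its place in a sorted tail takes one neighbouring swap for every smaller entry.
  The prefix \<open>P\<close> is carried along so that the induction can step into the tail.
\<close>

lemma minor_insort:
  assumes "sorted L" and "length J = length P + Suc (length L)"
  shows "minor X (P @ x # L) J = (-1) ^ length (filter (\<lambda>s. s < x) L) * minor X (P @ insort x L) J"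
  using assms
proof (induction L arbitrary: P)
  case (Cons l L)
  show ?case
  proof (cases "x \<le> l")
    case True
    then have "filter (\<lambda>s. s < x) (l # L) = []"
      using Cons.prems by (auto simp: filter_empty_conv)
    then show ?thesis using True by simp
  next
    case False
    have "minor X (P @ x # l # L) J = - minor X ((P @ [l]) @ x # L) J"
      using minor_swap[of J P L X x l] Cons.prems by simp
    also have "\<dots> = - ((-1) ^ length (filter (\<lambda>s. s < x) L) * minor X ((P @ [l]) @ insort x L) J)"
      by (subst Cons.IH) (use Cons.prems in auto)
    finally show ?thesis using False by simp
  qed
qed simp

lemma minor_sort_aux:
  assumes "length J = length P + length L"
  shows "minor X (P @ L) J = inversion_sign L * minor X (P @ sort L) J"
  using assms
proof (induction L arbitrary: P)
  case (Cons x L)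
  have "minor X (P @ x # L) J = inversion_sign L * minor X (P @ x # sort L) J"
    using Cons.IH[of "P @ [x]"] Cons.prems by simp
  also have "\<dots> = inversion_sign L * ((-1) ^ length (filter (\<lambda>s. s < x) (sort L)) * minor X (P @ insort x (sort L)) J)"
    by (subst minor_insort) (use Cons.prems in auto)
  also have "length (filter (\<lambda>s. s < x) (sort L)) = length (filter (\<lambda>s. s < x) L)"
    by (metis filter_sort length_sort)
  finally show ?case by (simp add: ac_simps)
qed simp

lemma minor_sort:
  assumes "length J = length L"
  shows "minor X L J = inversion_sign L * minor X (sort L) J"
  using minor_sort_aux[of J "[]" L X] assms by simp

text \<open>
  Repeating the column \<open>c\<close> gives a square array with two equal columns; its vanishing determinant,
  expanded along the additional column, is the linear dependence of \<open>k + 1\<close> vectors in a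
  \<open>k\<close>-dimensional space with coefficients given by Cramer's rule.
\<close>

lemma cramer_relation:
  assumes "length L = Suc (length J)" and "c \<in> set J"
  shows "(\<Sum>j<length L. (-1) ^ j * X (L ! j) c * minor X (del j L) J) = 0"
proof -
  have "(\<Sum>j<length L. (-1) ^ j * X (L ! j) c * minor X (del j L) J)
      = (\<Sum>j<length L. (-1) ^ j * X (L ! j) c * minor (\<lambda>i j. X j i) J (del j L))"
    using assms by (intro sum.cong refl arg_cong2[where f = "(*)"] minor_transpose) auto
  also have "\<dots> = minor (\<lambda>i j. X j i) (c # J) L"
    by (rule minor_laplace_row[symmetric]) (rule assms)
  also have "\<dots> = 0"
    using assms by (intro minor_not_distinct) auto
  finally show ?thesis .
qed

section \<open>The Cauchy-Binet formula\<close>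

text \<open>
  Every row of the product is a combination of rows of \<open>Y\<close>; multilinearity expands the determinant
  over all functions \<open>f\<close> choosing one row of \<open>Y\<close> for every row of the product. Fixing \<open>f\<close>
  outside \<open>{0..<length I}\<close> makes each choice occur only once.
\<close>

lemma minor_expand_rows:
  fixes X Y :: "nat \<Rightarrow> nat \<Rightarrow> 'a :: comm_ring_1"
  shows "minor (\<lambda>i j. \<Sum>l<n. X i l * Y l j) I J
    = (\<Sum>f\<in>{f. (\<forall>i\<in>{0..<length I}. f i \<in> {..<n}) \<and> (\<forall>i. i \<notin> {0..<length I} \<longrightarrow> f i = i)}.
         (\<Prod>i<length I. X (I ! i) (f i)) * minor Y (map f [0..<length I]) J)"
proof -
  let ?k = "length I"
  let ?r = "\<lambda>l. vec ?k (\<lambda>j. Y l (J ! j))"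
  let ?a = "\<lambda>i l. X (I ! i) l \<cdot>\<^sub>v ?r l"
  have "minor (\<lambda>i j. \<Sum>l<n. X i l * Y l j) I J
      = det (mat\<^sub>r ?k ?k (\<lambda>i. finsum_vec TYPE('a) ?k (?a i) {..<n}))"
    unfolding minor_def
    by (intro arg_cong[where f = det] eq_matI) (auto simp: index_finsum_vec)
  also have "\<dots> = (\<Sum>f\<in>{f. (\<forall>i\<in>{0..<?k}. f i \<in> {..<n}) \<and> (\<forall>i. i \<notin> {0..<?k} \<longrightarrow> f i = i)}.
      det (mat\<^sub>r ?k ?k (\<lambda>i. ?a i (f i))))"
    by (rule det_linear_rows_sum) auto
  also have "\<dots> = (\<Sum>f\<in>{f. (\<forall>i\<in>{0..<?k}. f i \<in> {..<n}) \<and> (\<forall>i. i \<notin> {0..<?k} \<longrightarrow> f i = i)}.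
         (\<Prod>i<?k. X (I ! i) (f i)) * minor Y (map f [0..<?k]) J)"
  proof (rule sum.cong[OF refl])
    fix f :: "nat \<Rightarrow> nat"
    have "det (mat\<^sub>r ?k ?k (\<lambda>i. ?a i (f i))) = prod (\<lambda>i. X (I ! i) (f i)) {0..<?k} * det (mat\<^sub>r ?k ?k (\<lambda>i. ?r (f i)))"
      by (rule det_rows_mul) auto
    also have "mat\<^sub>r ?k ?k (\<lambda>i. ?r (f i)) = mat ?k ?k (\<lambda>(i, j). Y (map f [0..<?k] ! i) (J ! j))"
      by (intro eq_matI) auto
    finally show "det (mat\<^sub>r ?k ?k (\<lambda>i. ?a i (f i))) = (\<Prod>i<?k. X (I ! i) (f i)) * minor Y (map f [0..<?k]) J"
      by (simp add: minor_def lessThan_atLeast0)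
  qed
  finally show ?thesis .
qed

abbreviation elems :: "nat set \<Rightarrow> nat list" where
  "elems \<equiv> sorted_list_of_set"

lemma index_setsD: "K \<in> index_sets n k \<Longrightarrow> finite K \<and> card K = k \<and> K \<subseteq> {..<n}"
  by (auto simp: index_sets_def intro: finite_subset)

lemma minor_identity:
  fixes A K :: "nat set"
  assumes "finite A" and "finite K" and "card A = card K"
  shows "minor (\<lambda>l j. if l = j then 1 else (0 :: 'a :: comm_ring_1)) (elems A) (elems K)
    = (if A = K then 1 else 0)"
proof (cases "A = K")
  case True
  let ?L = "elems K"
  have "mat (length ?L) (length ?L) (\<lambda>(i, j). if ?L ! i = ?L ! j then 1 else 0) = 1\<^sub>m (length ?L)"
    by (intro eq_matI) (auto simp: nth_eq_iff_index_eq)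
  then have "minor (\<lambda>l j. if l = j then 1 else (0 :: 'a)) ?L ?L = det (1\<^sub>m (length ?L))"
    unfolding minor_def by (rule arg_cong)
  then show ?thesis using True by simp
next
  case False
  then obtain t where "t \<in> A" "t \<notin> K"
    using assms by (metis card_subset_eq subsetI)
  then show ?thesis
    using assms False by (auto intro!: minor_zero_row[of t])
qed

text \<open>
  Sorting \<open>L\<close> shows that both sides equal the sorting sign times the minor on the index set
  \<open>set L\<close>: among the minors of the identity only the one with \<open>K = set L\<close> survives, and
  it carries exactly that sign.
\<close>

lemma minor_expand_identity:
  fixes Y :: "nat \<Rightarrow> nat \<Rightarrow> 'a :: comm_ring_1"
  assumes "set L \<subseteq> {..<n}" and "length J = length L"
  shows "minor Y L J = (\<Sum>K\<in>index_sets n (length L).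
    minor (\<lambda>l j. if l = j then 1 else 0) L (elems K) * minor Y (elems K) J)"
proof (cases "distinct L")
  case False
  then show ?thesis by (simp add: minor_not_distinct)
next
  case True
  let ?k = "length L" and ?A = "set L"
  have A: "?A \<in> index_sets n ?k"
    using True assms by (simp add: index_sets_def distinct_card)
  have sortL: "sort L = elems ?A"
    using True by (metis distinct_remdups_id sorted_list_of_set_sort_remdups)
  have "(\<Sum>K\<in>index_sets n ?k. minor (\<lambda>l j. if l = j then 1 else 0) L (elems K) * minor Y (elems K) J)
      = (\<Sum>K\<in>index_sets n ?k. if ?A = K then inversion_sign L * minor Y (elems K) J else 0)"
  proof (intro sum.cong refl)
    fix K assume "K \<in> index_sets n ?k"
    then have K: "finite K" "card K = ?k" by (auto dest: index_setsD)
    have "minor (\<lambda>l j. if l = j then 1 else 0) L (elems K)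
        = (inversion_sign L :: 'a) * (if ?A = K then 1 else 0)"
      using K True by (subst minor_sort) (auto simp: sortL minor_identity distinct_card)
    then show "minor (\<lambda>l j. if l = j then 1 else 0) L (elems K) * minor Y (elems K) J
      = (if ?A = K then inversion_sign L * minor Y (elems K) J else 0)" by simp
  qed
  also have "\<dots> = inversion_sign L * minor Y (sort L) J"
    unfolding sortL using A by (simp add: finite_index_sets sum.delta')
  also have "\<dots> = minor Y L J"
    using minor_sort[OF assms(2), of Y] by simp
  finally show ?thesis by (rule sym)
qed

text \<open>
  Expand the left hand side along all row choices \<open>f\<close>, split every minor of \<open>Y\<close> on the rows
  \<open>f\<close> as in \<open>minor_expand_identity\<close>, and exchange the sums. The sum over \<open>f\<close> that remains is the
  same row expansion of the minor of \<open>X = X \<cdot> 1\<close> on the columns \<open>K\<close>.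
\<close>

theorem cauchy_binet:
  fixes X Y :: "nat \<Rightarrow> nat \<Rightarrow> 'a :: comm_ring_1"
  assumes "length J = length I"
  shows "minor (\<lambda>i j. \<Sum>l<n. X i l * Y l j) I J
    = (\<Sum>K\<in>index_sets n (length I). minor X I (elems K) * minor Y (elems K) J)"
proof -
  let ?k = "length I"
  let ?F = "{f. (\<forall>i\<in>{0..<?k}. f i \<in> {..<n}) \<and> (\<forall>i. i \<notin> {0..<?k} \<longrightarrow> f i = i)}"
  let ?E = "\<lambda>l j. if l = j then 1 else (0 :: 'a)"
  let ?p = "\<lambda>f. \<Prod>i<?k. X (I ! i) (f i)"
  have X: "minor X I (elems K) = (\<Sum>f\<in>?F. ?p f * minor ?E (map f [0..<?k]) (elems K))"
    if "K \<in> index_sets n ?k" for K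
  proof -
    have "minor X I (elems K) = minor (\<lambda>i j. \<Sum>l<n. X i l * ?E l j) I (elems K)"
    proof (intro minor_cong)
      fix i j assume "j \<in> set (elems K)"
      then have "j < n" using index_setsD[OF that] by auto
      then show "X i j = (\<Sum>l<n. X i l * ?E l j)"
        by (simp add: if_distrib[of "\<lambda>x. _ * x"] cong: if_cong)
    qed (use that in \<open>auto dest: index_setsD\<close>)
    then show ?thesis by (simp only: minor_expand_rows)
  qed
  have "minor (\<lambda>i j. \<Sum>l<n. X i l * Y l j) I J = (\<Sum>f\<in>?F. ?p f * minor Y (map f [0..<?k]) J)"
    by (rule minor_expand_rows)
  also have "\<dots> = (\<Sum>f\<in>?F. ?p f *
      (\<Sum>K\<in>index_sets n ?k. minor ?E (map f [0..<?k]) (elems K) * minor Y (elems K) J))"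
  proof (intro sum.cong refl arg_cong2[where f = "(*)"])
    fix f assume "f \<in> ?F"
    then have "set (map f [0..<?k]) \<subseteq> {..<n}" by auto
    from minor_expand_identity[OF this, of J Y] assms
    show "minor Y (map f [0..<?k]) J =
      (\<Sum>K\<in>index_sets n ?k. minor ?E (map f [0..<?k]) (elems K) * minor Y (elems K) J)"
      by simp
  qed
  also have "\<dots> = (\<Sum>K\<in>index_sets n ?k. \<Sum>f\<in>?F.
      ?p f * (minor ?E (map f [0..<?k]) (elems K) * minor Y (elems K) J))"
    by (simp only: sum_distrib_left) (rule sum.swap)
  also have "\<dots> = (\<Sum>K\<in>index_sets n ?k. minor X I (elems K) * minor Y (elems K) J)"
    by (intro sum.cong refl) (simp only: X sum_distrib_right mult.assoc)
  finally show ?thesis .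
qed

section \<open>Pluecker relations\<close>

text \<open>
  The map \<open>v \<mapsto> det (v, R)\<close> is linear. Applying it to the dependence between the rows \<open>L\<close> of
  \<open>cramer_relation\<close> gives a quadratic relation between minors.
\<close>

lemma exchange_relation:
  assumes "length L = Suc (length J)" and "Suc (length R) = length J"
  shows "(\<Sum>j<length L. (-1) ^ j * minor X ((L ! j) # R) J * minor X (del j L) J) = 0"
proof -
  have "(\<Sum>j<length L. (-1) ^ j * minor X ((L ! j) # R) J * minor X (del j L) J)
      = (\<Sum>j<length L. \<Sum>i<length J. ((-1) ^ i * minor X R (del i J)) *
           ((-1) ^ j * X (L ! j) (J ! i) * minor X (del j L) J))"
  proof (intro sum.cong refl)
    fix j
    have "minor X ((L ! j) # R) J = (\<Sum>i<length J. (-1) ^ i * X (L ! j) (J ! i) * minor X R (del i J))"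
      by (rule minor_laplace_row) (use assms in simp)
    then show "(-1) ^ j * minor X ((L ! j) # R) J * minor X (del j L) J
      = (\<Sum>i<length J. ((-1) ^ i * minor X R (del i J)) *
           ((-1) ^ j * X (L ! j) (J ! i) * minor X (del j L) J))"
      by (simp add: sum_distrib_left sum_distrib_right ac_simps)
  qed
  also have "\<dots> = (\<Sum>i<length J. (-1) ^ i * minor X R (del i J) *
           (\<Sum>j<length L. (-1) ^ j * X (L ! j) (J ! i) * minor X (del j L) J))"
    by (subst sum.swap) (simp add: sum_distrib_left)
  also have "\<dots> = 0"
    using cramer_relation[OF assms(1), of _ X] by (intro sum.neutral) simp
  finally show ?thesis .
qed

lemma inversion_sign_sorted: "sorted L \<Longrightarrow> inversion_sign L = 1"
proof (induction L)
  case (Cons x L)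
  then have "filter (\<lambda>s. s < x) L = []"
    by (auto simp: filter_empty_conv)
  then show ?case using Cons by simp
qed simp

lemma sort_insert_elems:
  assumes "finite S" and "x \<notin> S" 
  shows "sort (x # elems S) = elems (insert x S)"
  using assms by (simp add: sorted_sort_id)

lemma minor_cons_elems:
  assumes "finite S" and "x \<notin> S" and "length J = Suc (card S)"
  shows "minor X (x # elems S) J
    = (-1) ^ length (filter (\<lambda>s. s < x) (elems S)) * minor X (elems (insert x S)) J"
proof -
  have "minor X (x # elems S) J = inversion_sign (x # elems S) * minor X (sort (x # elems S)) J"
    by (rule minor_sort) (use assms in simp)
  then show ?thesis
    unfolding sort_insert_elems[OF assms(1,2)] by (simp add: inversion_sign_sorted)
qed

lemma minor_cons2_elems:
  assumes "finite S" and "x \<notin> S" and "y \<notin> S" and "x < y" and "length J = card S + 2"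
  shows "minor X (x # y # elems S) J = (-1) ^ length (filter (\<lambda>s. s < x) (elems S))
      * (-1) ^ length (filter (\<lambda>s. s < y) (elems S)) * minor X (elems (S \<union> {x, y})) J"
    and "minor X (y # x # elems S) J = - ((-1) ^ length (filter (\<lambda>s. s < x) (elems S))
      * (-1) ^ length (filter (\<lambda>s. s < y) (elems S)) * minor X (elems (S \<union> {x, y})) J)"
proof -
  have "minor X (x # y # elems S) J = inversion_sign (x # y # elems S) * minor X (sort (x # y # elems S)) J"
    by (rule minor_sort) (use assms in simp)
  moreover have "sort (x # y # elems S) = elems (S \<union> {x, y})"
    using sort_insert_elems[of S y] sort_insert_elems[of "insert y S" x] assms
    by (simp add: insert_commute sorted_sort_id)
  ultimately show 1: "minor X (x # y # elems S) J = (-1) ^ length (filter (\<lambda>s. s < x) (elems S))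
      * (-1) ^ length (filter (\<lambda>s. s < y) (elems S)) * minor X (elems (S \<union> {x, y})) J"
    using assms(4) by (simp add: inversion_sign_sorted)
  have "minor X (y # x # elems S) J = - minor X (x # y # elems S) J"
    using minor_swap[of J "[]" "elems S" X y x] assms by simp
  then show "minor X (y # x # elems S) J = - ((-1) ^ length (filter (\<lambda>s. s < x) (elems S))
      * (-1) ^ length (filter (\<lambda>s. s < y) (elems S)) * minor X (elems (S \<union> {x, y})) J)"
    using 1 by simp
qed

text \<open>
  Take \<open>L = (b, c, d, S)\<close> and \<open>R = (a, S)\<close> in the exchange relation: the rows in \<open>S\<close> contribute
  nothing, since they repeat a row of \<open>R\<close>, and three terms remain. Sorting the rows
  multiplies all three products by the same sign, namely the product over \<open>a, b, c, d\<close> of the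
  parities of the number of smaller elements of \<open>S\<close>.
\<close>

lemma pluecker_relation:
  fixes X :: "nat \<Rightarrow> nat \<Rightarrow> 'a :: idom"
  assumes fin: "finite S" and J: "length J = card S + 2"
    and ord: "a < b" "b < c" "c < d" and S: "a \<notin> S" "b \<notin> S" "c \<notin> S" "d \<notin> S"
  shows "minor X (elems (S \<union> {a, c})) J * minor X (elems (S \<union> {b, d})) J
    = minor X (elems (S \<union> {a, b})) J * minor X (elems (S \<union> {c, d})) J
      + minor X (elems (S \<union> {a, d})) J * minor X (elems (S \<union> {b, c})) J"
proof -
  let ?s = "elems S"
  let ?L = "b # c # d # ?s"
  let ?F = "\<lambda>K. minor X (elems K) J"
  let ?e = "\<lambda>z. (-1 :: 'a) ^ length (filter (\<lambda>s. s < z) ?s)"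
  let ?P = "?e a * ?e b * ?e c * ?e d"
  let ?D = "?F (S \<union> {a, c}) * ?F (S \<union> {b, d}) - ?F (S \<union> {a, b}) * ?F (S \<union> {c, d})
    - ?F (S \<union> {a, d}) * ?F (S \<union> {b, c})"
  let ?t = "\<lambda>j. (-1) ^ j * minor X ((?L ! j) # a # ?s) J * minor X (del j ?L) J"
  have "0 = (\<Sum>j<length ?L. ?t j)"
    by (rule exchange_relation[symmetric]) (use J in auto)
  also have "\<dots> = (\<Sum>j<3. ?t j)"
  proof (rule sum.mono_neutral_right)
    show "\<forall>j\<in>{..<length ?L} - {..<3}. ?t j = 0"
    proof
      fix j assume j: "j \<in> {..<length ?L} - {..<3}"
      then have "j - 3 < length ?s" "?L ! j = ?s ! (j - 3)"
        by (auto simp: nth_Cons split: nat.splits)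
      then have "?L ! j \<in> set ?s"
        by (metis nth_mem)
      then show "?t j = 0"
        by (simp add: minor_not_distinct)
    qed
  qed auto
  also have "\<dots> = minor X (b # a # ?s) J * minor X (c # d # ?s) J
      - minor X (c # a # ?s) J * minor X (b # d # ?s) J
      + minor X (d # a # ?s) J * minor X (b # c # ?s) J"
    by (simp add: numeral_3_eq_3 del_def)
  also have "\<dots> = ?P * ?D"
    using ord S fin J by (simp add: minor_cons2_elems algebra_simps)
  finally have "?P * ?D = 0" by (rule sym)
  then have "?P = 0 \<or> ?D = 0" by (rule iffD1[OF mult_eq_0_iff])
  moreover have "?P \<noteq> 0" by simp
  ultimately have "?D = 0" by blast
  then show ?thesis by (simp only: algebra_simps add_0)
qed

section \<open>A positivity test for Pluecker coordinates\<close>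

text \<open>
  The three-term relation determines each value from values on sets that are closer to the initial ones,
  those consisting of a segment \<open>{..<m}\<close> and one further block, and it does so without subtraction.
  Positivity is shown for the sets containing \<open>{..<j}\<close>, by descending induction on \<open>j\<close>, and for
  fixed \<open>j\<close> by induction on the distance between the least and the greatest element of
  \<open>\<alpha> - {..<j}\<close>. If this rest is not a block, it omits some \<open>c\<close> between its ends \<open>b\<close> and \<open>d\<close>.
  In the relation for \<open>j < b < c < d\<close> and \<open>S = \<alpha> - {b, d}\<close> the factors whose set contains
  \<open>j\<close> are positive by the outer induction, those on \<open>S \<union> {b, c}\<close> and \<open>S \<union> {c, d}\<close> by the
  inner one; only the factor on \<open>\<alpha> = S \<union> {b, d}\<close> is left and must be positive.
\<close>

theorem pluecker_positive:
  fixes F :: "nat set \<Rightarrow> real"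
  assumes pluecker: "\<And>S a b c d. finite S \<Longrightarrow> S \<subseteq> {..<N} \<Longrightarrow> card S + 2 = k \<Longrightarrow> a < b \<Longrightarrow> b < c \<Longrightarrow> c < d \<Longrightarrow> d < N
      \<Longrightarrow> a \<notin> S \<Longrightarrow> b \<notin> S \<Longrightarrow> c \<notin> S \<Longrightarrow> d \<notin> S \<Longrightarrow>
      F (S \<union> {a, c}) * F (S \<union> {b, d}) = F (S \<union> {a, b}) * F (S \<union> {c, d}) + F (S \<union> {a, d}) * F (S \<union> {b, c})"
    and initial: "\<And>m s. m < k \<Longrightarrow> m \<le> s \<Longrightarrow> s + (k - m) \<le> N \<Longrightarrow> F ({..<m} \<union> {s..<s + (k - m)}) > 0"
    and "1 \<le> k" and "\<alpha> \<in> index_sets N k"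
  shows "F \<alpha> > 0"
proof -
  have "\<forall>\<alpha>\<in>index_sets N k. {..<j} \<subseteq> \<alpha> \<longrightarrow> F \<alpha> > 0" if "j \<le> k" for j
    using that
  proof (induction j rule: inc_induct)
    case base
    show ?case
    proof (intro ballI impI)
      fix \<alpha> assume "\<alpha> \<in> index_sets N k" and sub: "{..<k} \<subseteq> \<alpha>"
      then have \<alpha>: "finite \<alpha>" "card \<alpha> = k" "\<alpha> \<subseteq> {..<N}" by (auto dest: index_setsD)
      then have "{..<k} = \<alpha>" using sub by (intro card_subset_eq) auto
      moreover have "k \<le> N" using \<alpha> card_mono[of "{..<N}" \<alpha>] by simp
      ultimately show "F \<alpha> > 0" using initial[of 0 0] \<open>1 \<le> k\<close> by (simp add: lessThan_atLeast0)
    qed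
  next
    case (step j)
    have "F \<alpha> > 0" if "\<alpha> \<in> index_sets N k" "{..<j} \<subseteq> \<alpha>" for \<alpha>
      using that
    proof (induction "Max (\<alpha> - {..<j}) - Min (\<alpha> - {..<j})" arbitrary: \<alpha> rule: less_induct)
      case less
      let ?\<gamma> = "\<alpha> - {..<j}"
      let ?b = "Min ?\<gamma>" and ?d = "Max ?\<gamma>"
      have \<alpha>: "finite \<alpha>" "card \<alpha> = k" "\<alpha> \<subseteq> {..<N}" using less.prems by (auto dest: index_setsD)
      have card: "card ?\<gamma> = k - j" using \<alpha> less.prems by (simp add: card_Diff_subset)
      then have ne: "?\<gamma> \<noteq> {}" using step.hyps by (metis card.empty zero_less_diff less_irrefl)
      have fin: "finite ?\<gamma>" using \<alpha> by simp
      have bd: "?b \<in> ?\<gamma>" "?d \<in> ?\<gamma>" using Min_in[OF fin ne] Max_in[OF fin ne] by auto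
      have bd_le: "?b \<le> x" "x \<le> ?d" if "x \<in> ?\<gamma>" for x using that fin by auto
      show ?case
      proof (cases "j \<in> \<alpha>")
        case True
        then have "{..<Suc j} \<subseteq> \<alpha>" using less.prems by (auto simp: less_Suc_eq)
        then show ?thesis using step.IH less.prems by blast
      next
        case j: False
        show ?thesis
        proof (cases "?\<gamma> = {?b..?d}")
          case True
          then have "Suc ?d - ?b = k - j" using card by (metis card_atLeastAtMost)
          moreover have "?b \<le> ?d" using bd bd_le by blast
          ultimately have d: "?d + 1 = ?b + (k - j)" by linarith
          then have "\<alpha> = {..<j} \<union> {?b..<?b + (k - j)}"
            using True less.prems(2) by (metis Diff_partition atLeastLessThanSuc_atLeastAtMost Suc_eq_plus1)
          moreover have "?b + (k - j) \<le> N" using d bd \<alpha> by (metis Diff_iff Suc_eq_plus1 Suc_le_eq lessThan_iff subsetD)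
          ultimately show ?thesis
            using initial[of j ?b] bd step.hyps by auto
        next
          case False
          have "?\<gamma> \<subseteq> {?b..?d}" using bd_le by (meson atLeastAtMost_iff subsetI)
          then obtain c where c: "?b \<le> c" "c \<le> ?d" "c \<notin> ?\<gamma>" using False by (meson atLeastAtMost_iff subsetI subset_antisym)
          then have ord: "j < ?b" "?b < c" "c < ?d" "?d < N" and c\<alpha>: "c \<notin> \<alpha>"
            using bd j \<alpha> by (auto simp: le_less)
          define b d where "b = ?b" and "d = ?d"
          note ord = ord[folded b_def d_def] and bd = bd[folded b_def d_def]
            and bd_le = bd_le[folded b_def d_def]
          define S where "S = \<alpha> - {b, d}"
          have fS: "finite S" and cS: "card S + 2 = k" and SN: "S \<subseteq> {..<N}" and jS: "{..<j} \<subseteq> S"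
          proof -
            show "finite S" "S \<subseteq> {..<N}" using \<alpha> by (auto simp: S_def)
            have "card S = card \<alpha> - card {b, d}"
              unfolding S_def using bd by (intro card_Diff_subset) auto
            moreover have "card {b, d} = 2" using ord by simp
            moreover have "card {b, d} \<le> card \<alpha>" using bd \<alpha> by (intro card_mono) auto
            ultimately show "card S + 2 = k" using \<alpha> by simp
            show "{..<j} \<subseteq> S" using less.prems ord unfolding S_def by auto
          qed
          have nS: "j \<notin> S" "b \<notin> S" "c \<notin> S" "d \<notin> S" using j c\<alpha> by (auto simp: S_def)
          have \<alpha>_eq: "S \<union> {b, d} = \<alpha>" using bd by (auto simp: S_def)
          have mem: "S \<union> {x, y} \<in> index_sets N k" if "x \<notin> S" "y \<notin> S" "x < y" "y < N" for x y
            using that fS cS SN by (auto simp: index_sets_def)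
          have a_pos: "F (S \<union> {j, y}) > 0" if "y \<notin> S" "j < y" "y < N" for y
          proof -
            have "{..<Suc j} \<subseteq> S \<union> {j, y}" using jS by (auto simp: less_Suc_eq)
            then show ?thesis using step.IH mem[of j y] that nS by blast
          qed
          have spread: "F (S \<union> {x, y}) > 0"
            if xy: "b \<le> x" "x < y" "y \<le> d" "x \<notin> S" "y \<notin> S" "b < x \<or> y < d" for x y
          proof (rule less.hyps[of "S \<union> {x, y}"])
            let ?\<delta> = "S \<union> {x, y} - {..<j}"
            have f: "finite ?\<delta>" and n: "?\<delta> \<noteq> {}" using fS ord xy by auto
            have r: "z \<in> {b..d}" "z = b \<longrightarrow> x = b" "z = d \<longrightarrow> y = d" if "z \<in> ?\<delta>" for z
              using that xy bd_le[of z] ord by (auto simp: S_def)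
            define p q where "p = Min ?\<delta>" and "q = Max ?\<delta>"
            have m: "p \<in> ?\<delta>" "q \<in> ?\<delta>"
              unfolding p_def q_def by (rule Min_in[OF f n], rule Max_in[OF f n])
            have "p \<le> q"
              unfolding q_def using Max_ge[OF f m(1)] .
            then have "q - p < d - b"
              using r(1)[OF m(1)] r(2)[OF m(1)] r(1)[OF m(2)] r(3)[OF m(2)] xy(2,6) ord
              unfolding atLeastAtMost_iff by linarith
            then show "Max ?\<delta> - Min ?\<delta> < Max ?\<gamma> - Min ?\<gamma>"
              unfolding p_def q_def b_def d_def .
            show "S \<union> {x, y} \<in> index_sets N k" using mem xy ord by auto
            show "{..<j} \<subseteq> S \<union> {x, y}" using jS by auto
          qed
          have "F (S \<union> {j, c}) * F (S \<union> {b, d})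
              = F (S \<union> {j, b}) * F (S \<union> {c, d}) + F (S \<union> {j, d}) * F (S \<union> {b, c})"
            by (rule pluecker[OF fS SN cS ord nS])
          also have "\<dots> > 0"
            using a_pos[of b] a_pos[of d] spread[of c d] spread[of b c] ord nS
            by (intro add_pos_pos mult_pos_pos) auto
          finally have "F (S \<union> {j, c}) * F \<alpha> > 0" unfolding \<alpha>_eq .
          moreover have "F (S \<union> {j, c}) > 0"
            using a_pos[OF nS(3)] ord by linarith
          ultimately show ?thesis by (rule zero_less_mult_pos)
        qed
      qed
    qed
    then show ?case by blast
  qed
  from this[of 0] show ?thesis using assms(4) by simp
qed

section \<open>Compound matrices\<close>

lemma elems_eq_iff: "finite A \<Longrightarrow> sorted_wrt (<) L \<Longrightarrow> set L = A \<Longrightarrow> elems A = L"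
  by (rule strict_sorted_equal) auto

lemma elems_lessThan: "elems {..<k} = [0..<k]"
  by (rule elems_eq_iff) auto

lemma elems_nth_pick:
  assumes "finite I" and "i < card I"
  shows "pick I i = elems I ! i"
proof -
  let ?L = "map (pick I) [0..<card I]"
  have "inj_on (pick I) {0..<card I}"
    by (rule linorder_inj_onI) (auto dest: pick_mono_le)
  then have "card (pick I ` {0..<card I}) = card I"
    by (simp add: card_image)
  moreover have "pick I ` {0..<card I} \<subseteq> I"
    using pick_in_set_le by auto
  ultimately have "set ?L = I"
    using assms by (simp add: card_subset_eq)
  then have "elems I = ?L"
    using assms by (intro elems_eq_iff) (auto simp: sorted_wrt_iff_nth_less intro: pick_mono_le)
  then show ?thesis using assms by simp
qed

text \<open>
  Both describe the same determinant: \<open>pick\<close> enumerates an index set in increasing order.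
\<close>

lemma det_submatrix:
  assumes "I \<subseteq> {..<dim_row X}" and "J \<subseteq> {..<dim_col X}" and "card I = card J"
  shows "det (submatrix X I J) = minor (\<lambda>i j. X $$ (i, j)) (elems I) (elems J)"
proof -
  have fin: "finite I" "finite J" using assms finite_subset by auto
  have "{i. i < dim_row X \<and> i \<in> I} = I" "{j. j < dim_col X \<and> j \<in> J} = J" using assms by auto
  then have "submatrix X I J = mat (card I) (card J) (\<lambda>(i, j). X $$ (elems I ! i, elems J ! j))"
    using fin by (intro eq_matI) (auto simp: submatrix_def elems_nth_pick)
  then show ?thesis using assms fin by (simp add: minor_def)
qed

lemma lex_index_sets_elems:
  shows "set (lex_index_sets n k) = index_sets n k" and "distinct (lex_index_sets n k)"
proof -
  have fin: "finite K" if "K \<in> index_sets n k" for K using that by (auto dest: index_setsD)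
  show 1: "set (lex_index_sets n k) = index_sets n k"
    using fin by (force simp: lex_index_sets_def finite_index_sets image_image)
  have "card (index_sets n k) = length (lex_index_sets n k)"
    unfolding length_lex_index_sets index_sets_def by (simp add: n_subsets)
  then show "distinct (lex_index_sets n k)"
    using 1 by (intro card_distinct) simp
qed

lemma lex_index_sets_nth: "i < n choose k \<Longrightarrow> lex_index_sets n k ! i \<in> index_sets n k"
  using lex_index_sets_elems(1) by (metis length_lex_index_sets nth_mem)

lemma sum_lex_index_sets: "(\<Sum>i<n choose k. f (lex_index_sets n k ! i)) = (\<Sum>K\<in>index_sets n k. f K)"
proof (rule sum.reindex_bij_betw)
  show "bij_betw ((!) (lex_index_sets n k)) {..<n choose k} (index_sets n k)"
    using lex_index_sets_elems by (intro bij_betw_nth) (auto simp: length_lex_index_sets)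
qed

lemma compound_index:
  assumes "X \<in> carrier_mat p q" and "i < p choose r" and "j < q choose r"
  shows "compound r X $$ (i, j)
    = minor (\<lambda>i j. X $$ (i, j)) (elems (lex_index_sets p r ! i)) (elems (lex_index_sets q r ! j))"
proof -
  have "lex_index_sets p r ! i \<in> index_sets p r" "lex_index_sets q r ! j \<in> index_sets q r"
    using assms by (simp_all add: lex_index_sets_nth)
  then show ?thesis
    using assms by (auto simp: compound_def length_lex_index_sets index_sets_def intro!: det_submatrix)
qed

lemma index_mult_mat_sum:
  assumes "X \<in> carrier_mat p m" and "Y \<in> carrier_mat m q" and "i < p" and "j < q"
  shows "(X * Y) $$ (i, j) = (\<Sum>l<m. X $$ (i, l) * Y $$ (l, j))"
  using assms by (auto simp: scalar_prod_def lessThan_atLeast0 intro!: sum.cong)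

text \<open>
  Multiplicativity of compound matrices is the Cauchy-Binet formula, entry by entry.
\<close>

theorem compound_mult:
  assumes "X \<in> carrier_mat p m" and "Y \<in> carrier_mat m q"
  shows "compound r (X * Y) = compound r X * compound r Y"
proof (rule eq_matI)
  note carr = compound_carrier[OF assms(1), of r] compound_carrier[OF assms(2), of r]
  fix i j assume "i < dim_row (compound r X * compound r Y)" "j < dim_col (compound r X * compound r Y)"
  then have ij: "i < p choose r" "j < q choose r" using carr by auto
  let ?I = "lex_index_sets p r ! i" and ?J = "lex_index_sets q r ! j"
  have I: "?I \<in> index_sets p r" and J: "?J \<in> index_sets q r" using ij by (simp_all add: lex_index_sets_nth)
  then have len: "length (elems ?I) = r" "length (elems ?J) = r" by (auto dest!: index_setsD)
  have "compound r (X * Y) $$ (i, j) = minor (\<lambda>i j. (X * Y) $$ (i, j)) (elems ?I) (elems ?J)"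
    using assms ij by (intro compound_index[of _ p q]) auto
  also have "\<dots> = minor (\<lambda>i j. \<Sum>l<m. X $$ (i, l) * Y $$ (l, j)) (elems ?I) (elems ?J)"
    using index_setsD[OF I] index_setsD[OF J]
    by (intro minor_cong index_mult_mat_sum[OF assms]) auto
  also have "\<dots> = (\<Sum>K\<in>index_sets m r. minor (\<lambda>i j. X $$ (i, j)) (elems ?I) (elems K)
      * minor (\<lambda>i j. Y $$ (i, j)) (elems K) (elems ?J))"
    by (subst cauchy_binet) (simp_all only: len)
  also have "\<dots> = (\<Sum>l<m choose r. compound r X $$ (i, l) * compound r Y $$ (l, j))"
    unfolding sum_lex_index_sets[symmetric]
    using assms ij by (intro sum.cong) (auto simp: compound_index)
  also have "\<dots> = (compound r X * compound r Y) $$ (i, j)"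
    using index_mult_mat_sum[OF carr ij] by simp
  finally show "compound r (X * Y) $$ (i, j) = (compound r X * compound r Y) $$ (i, j)" .
qed (use compound_carrier[of X p m r] compound_carrier[of Y m q r] compound_carrier[of "X * Y" p q r] assms in auto)

text \<open>
  The factor \<open>compound r X\<close> is carried along so that the case \<open>s = 0\<close> amounts to multiplication
  by an identity matrix on both sides.
\<close>

lemma compound_mult_pow:
  assumes "X \<in> carrier_mat p n" and "A \<in> carrier_mat n n"
  shows "compound r X * compound r A ^\<^sub>m s = compound r (X * A ^\<^sub>m s)"
proof (induction s)
  case 0
  have "dim_row (compound r A) = n choose r" 
    using compound_carrier[OF assms(2)] by auto
  then show ?case using assms right_mult_one_mat[OF compound_carrier[OF assms(1), of r]] by simp
next
  case (Suc s)
  note carr = compound_carrier[OF assms(1), of r] compound_carrier[OF assms(2), of r]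
  have "compound r X * compound r A ^\<^sub>m Suc s = (compound r X * compound r A ^\<^sub>m s) * compound r A"
    using carr by (simp add: assoc_mult_mat[of _ _ "n choose r" _ "n choose r"])
  also have "\<dots> = compound r ((X * A ^\<^sub>m s) * A)"
    unfolding Suc.IH using assms by (intro compound_mult[symmetric]) auto
  also have "(X * A ^\<^sub>m s) * A = X * A ^\<^sub>m Suc s"
    using assms by (simp add: assoc_mult_mat[of _ _ n _ n])
  finally show ?case .
qed

text \<open>
  The enumerations of the index sets, described without reference to the sets; this is the form
  in which the lexicographic order can be decomposed.
\<close>

definition increasing_lists :: "nat \<Rightarrow> nat \<Rightarrow> nat list set" where
  "increasing_lists n k = {L. sorted_wrt (<) L \<and> set L \<subseteq> {..<n} \<and> length L = k}"

lemma elems_index_sets: "elems ` index_sets n k = increasing_lists n k"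
proof (intro equalityI subsetI)
  fix L assume L: "L \<in> increasing_lists n k"
  then have "elems (set L) = L" by (intro elems_eq_iff) (auto simp: increasing_lists_def)
  moreover have "set L \<in> index_sets n k"
    using L by (auto simp: index_sets_def increasing_lists_def distinct_card strict_sorted_iff)
  ultimately show "L \<in> elems ` index_sets n k" by (metis imageI)
next
  fix L assume "L \<in> elems ` index_sets n k"
  then obtain K where "K \<in> index_sets n k" "L = elems K" by blast
  with index_setsD[of K n k] show "L \<in> increasing_lists n k"
    by (auto simp: increasing_lists_def)
qed

lemma increasing_lists_Suc:
  "increasing_lists (Suc n) (Suc k)
    = (\<lambda>L. 0 # map Suc L) ` increasing_lists n k \<union> map Suc ` increasing_lists n (Suc k)" (is "?A = ?B \<union> ?C")
proof (intro equalityI subsetI)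
  fix L assume L: "L \<in> ?A"
  have pre: "L' \<in> map Suc ` increasing_lists n (length L')"
    if "sorted_wrt (<) L'" "set L' \<subseteq> {0<..<Suc n}" for L'
  proof (rule image_eqI)
    show eq: "L' = map Suc (map (\<lambda>x. x - 1) L')"
      using that by (intro nth_equalityI) (auto dest!: subsetD nth_mem)
    have "sorted_wrt (<) (map Suc (map (\<lambda>x. x - 1) L'))" "set (map Suc (map (\<lambda>x. x - 1) L')) \<subseteq> {0<..<Suc n}"
      unfolding eq[symmetric] by (fact that)+
    then show "map (\<lambda>x. x - 1) L' \<in> increasing_lists n (length L')"
      by (auto simp: increasing_lists_def sorted_wrt_map)
  qed
  show "L \<in> ?B \<union> ?C"
  proof (cases L)
    case (Cons x xs)
    have x: "sorted_wrt (<) xs" "\<forall>y\<in>set xs. x < y" "set xs \<subseteq> {..<Suc n}" "length xs = k" "x < Suc n"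
      using L Cons by (auto simp: increasing_lists_def)
    show ?thesis
    proof (cases "x = 0")
      case True
      then have "set xs \<subseteq> {0<..<Suc n}" using x by force
      then obtain L' where "L' \<in> increasing_lists n k" "xs = map Suc L'" using pre[of xs] x by blast
      then show ?thesis using True Cons by blast
    next
      case False
      then have "set L \<subseteq> {0<..<Suc n}" using x Cons by force
      then show ?thesis using pre[of L] x Cons by auto
    qed
  qed (use L in \<open>simp add: increasing_lists_def\<close>)
next
  fix L assume "L \<in> ?B \<union> ?C"
  then show "L \<in> ?A" by (auto simp: increasing_lists_def sorted_wrt_map)
qed

lemma finite_increasing_lists: "finite (increasing_lists n k)"
  unfolding elems_index_sets[symmetric] by (simp add: finite_index_sets)

lemma map_Suc_less: "map Suc L < map Suc L' \<longleftrightarrow> L < (L' :: nat list)"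
  by (induction L arbitrary: L'; case_tac L') auto

text \<open>
  In the lexicographic order the sets that contain \<open>0\<close> precede those that do not.
\<close>

lemma lex_index_sets_Suc:
  "lex_index_sets (Suc n) (Suc k)
    = map (\<lambda>K. insert 0 (Suc ` K)) (lex_index_sets n k) @ map ((`) Suc) (lex_index_sets n (Suc k))"
proof -
  let ?S = "\<lambda>n k. sorted_list_of_set (increasing_lists n k)"
  have "?S (Suc n) (Suc k) = map (\<lambda>L. 0 # map Suc L) (?S n k) @ map (map Suc) (?S n (Suc k))"
  proof (rule strict_sorted_equal)
    have mono: "sorted_wrt (<) (?S n j)" for j by simp
    have "0 # map Suc L < L'" if L': "L' \<in> map Suc ` increasing_lists n (Suc k)" for L L' :: "nat list"
    proof -
      obtain y ys where "L' = Suc y # ys"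
        using L' by (auto simp: increasing_lists_def length_Suc_conv)
      then show ?thesis by simp
    qed
    then show "sorted_wrt (<) (map (\<lambda>L. 0 # map Suc L) (?S n k) @ map (map Suc) (?S n (Suc k)))"
      using mono[of k] mono[of "Suc k"]
      by (auto simp: sorted_wrt_append sorted_wrt_map map_Suc_less finite_increasing_lists)
  qed (simp_all add: finite_increasing_lists increasing_lists_Suc)
  then show ?thesis
    by (simp add: lex_index_sets_def elems_index_sets)
qed

lemma binomial_add_mono: "n choose k \<le> (m + n) choose (m + k)"
  by (induction m) (auto intro: le_trans)

text \<open>
  Consequently the sets containing \<open>{..<m}\<close> come first, in the order of their remaining elements.
  This is why the zero block in \<open>b_tilde\<close> selects exactly those minors whose rows include
  \<open>{..<m}\<close>.
\<close>

lemma lex_index_sets_prefix: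
  "i < n choose k \<Longrightarrow>
    lex_index_sets (m + n) (m + k) ! i = {..<m} \<union> (\<lambda>x. m + x) ` (lex_index_sets n k ! i)"
proof (induction m)
  case (Suc m)
  then have i: "i < (m + n) choose (m + k)" using Suc.prems less_le_trans binomial_add_mono by blast
  have "lex_index_sets (Suc m + n) (Suc m + k) ! i = insert 0 (Suc ` (lex_index_sets (m + n) (m + k) ! i))"
    using i by (simp add: lex_index_sets_Suc nth_append length_lex_index_sets)
  also have "\<dots> = insert 0 (Suc ` ({..<m} \<union> (\<lambda>x. m + x) ` (lex_index_sets n k ! i)))"
    using Suc by simp
  also have "\<dots> = {..<Suc m} \<union> (\<lambda>x. Suc m + x) ` (lex_index_sets n k ! i)"
    by (auto simp: image_Un image_image lessThan_Suc_eq_insert_0)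
  finally show ?case .
qed simp

text \<open>
  If the rows in \<open>P\<close> agree with those of the identity, the array is block triangular with an identity
  block on the diagonal.
\<close>

lemma minor_unit_prefix:
  assumes "distinct P" and "\<And>p. p \<in> set P \<Longrightarrow> X p p = 1"
    and "\<And>p q. p \<in> set P \<Longrightarrow> q \<in> set P \<union> set J \<Longrightarrow> p \<noteq> q \<Longrightarrow> X p q = 0"
    and "set P \<inter> set J = {}" and "length I = length J"
  shows "minor X (P @ I) (P @ J) = minor X I J"
  using assms
proof (induction P)
  case (Cons p P)
  have "minor X (p # P @ I) (p # P @ J)
      = (\<Sum>j<length (p # P @ J). (-1) ^ j * X p ((p # P @ J) ! j) * minor X (P @ I) (del j (p # P @ J)))"
    by (rule minor_laplace_row) (use Cons.prems in simp)
  also have "\<dots> = (\<Sum>j<1. (-1) ^ j * X p ((p # P @ J) ! j) * minor X (P @ I) (del j (p # P @ J)))"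
  proof (rule sum.mono_neutral_right)
    show "\<forall>j\<in>{..<length (p # P @ J)} - {..<1}. (-1) ^ j * X p ((p # P @ J) ! j) * minor X (P @ I) (del j (p # P @ J)) = 0"
    proof
      fix j assume "j \<in> {..<length (p # P @ J)} - {..<1}"
      then obtain j' where "(p # P @ J) ! j = (P @ J) ! j'" "j' < length (P @ J)"
        by (cases j) auto
      then have "(p # P @ J) ! j \<in> set (P @ J)" by (metis nth_mem)
      then have "X p ((p # P @ J) ! j) = 0"
        using Cons.prems by (intro Cons.prems(3)) auto
      then show "(-1) ^ j * X p ((p # P @ J) ! j) * minor X (P @ I) (del j (p # P @ J)) = 0" by simp
    qed
  qed auto
  also have "\<dots> = minor X (P @ I) (P @ J)"
    using Cons.prems by (simp add: del_def)
  also have "\<dots> = minor X I J"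
    by (rule Cons.IH) (use Cons.prems in auto)
  finally show ?case by simp
qed simp

section \<open>Minors of the observability matrices\<close>

lemma elems_prefix_block:
  assumes "finite J"
  shows "elems ({..<m} \<union> (\<lambda>x. m + x) ` J) = [0..<m] @ map (\<lambda>x. m + x) (elems J)"
  by (rule elems_eq_iff) (use assms in \<open>auto simp: sorted_wrt_append sorted_wrt_map\<close>)

lemma elems_initial:
  assumes "m \<le> s"
  shows "elems ({..<m} \<union> {s..<s + r}) = [0..<m] @ [s..<s + r]"
  by (rule elems_eq_iff) (use assms in \<open>auto simp: sorted_wrt_append\<close>)

text \<open>
  An index set consisting of a segment starting at \<open>0\<close> and one further block is called initial. With
  \<open>p = k - r\<close> and \<open>s = k - r + t - 1\<close> it is the row set of the minor computed by the \<open>r\<close>-th compound system at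
  time \<open>t\<close>.
\<close>

lemma initial_index_set:
  assumes "p \<le> k" and "p \<le> s" and "s + (k - p) \<le> N"
  shows "{..<p} \<union> {s..<s + (k - p)} \<in> index_sets N k"
proof -
  have "card ({..<p} \<union> {s..<s + (k - p)}) = card {..<p} + card {s..<s + (k - p)}"
    using assms by (intro card_Un_disjoint) auto
  then show ?thesis using assms by (auto simp: index_sets_def)
qed

locale observable_pair =
  fixes A c :: "real mat" and n :: nat
  assumes A: "A \<in> carrier_mat n n" and c: "c \<in> carrier_mat 1 n" and observable: "observable A c"
begin

definition output_coeff :: "nat \<Rightarrow> nat \<Rightarrow> real" where
  "output_coeff t j = (c * A ^\<^sub>m t) $$ (0, j)"

definition obs_inv :: "real mat" where
  "obs_inv = the (mat_inverse (obs_mat A c n))"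

text \<open>
  The coordinates of the row \<open>c A\<^sup>t\<close> with respect to the basis formed by the first \<open>n\<close> rows
  \<open>c, c A, \<dots>\<close> of the observability matrix.
\<close>

definition state_coord :: "nat \<Rightarrow> nat \<Rightarrow> real" where
  "state_coord t l = (c * A ^\<^sub>m t * obs_inv) $$ (0, l)"

lemma pow_carrier: "A ^\<^sub>m t \<in> carrier_mat n n"
  using A by simp

lemma row_carrier: "c * A ^\<^sub>m t \<in> carrier_mat 1 n"
  using c pow_carrier by (rule mult_carrier_mat)

lemma obs_mat_carrier: "obs_mat A c N \<in> carrier_mat N n"
  using A by (simp add: obs_mat_def)

lemma obs_mat_index: "i < N \<Longrightarrow> j < n \<Longrightarrow> obs_mat A c N $$ (i, j) = output_coeff i j"
  using A by (simp add: obs_mat_def output_coeff_def)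

lemma obs_inv:
  shows "obs_mat A c n * obs_inv = 1\<^sub>m n" and "obs_inv * obs_mat A c n = 1\<^sub>m n"
    and obs_inv_carrier: "obs_inv \<in> carrier_mat n n"
proof -
  let ?O = "obs_mat A c n"
  have "invertible_mat ?O"
    using observable A by (simp add: observable_def)
  then obtain B where B: "?O * B = 1\<^sub>m n" "B * ?O = 1\<^sub>m (dim_row B)"
    using obs_mat_carrier[of n] by (auto simp: invertible_mat_def inverts_mat_def)
  have "dim_col B = n" using arg_cong[OF B(1), of dim_col] by simp
  moreover have "dim_row B = n" using arg_cong[OF B(2), of dim_col] obs_mat_carrier[of n] by simp
  ultimately have "?O \<in> Units (ring_mat TYPE(real) n ())"
    using B obs_mat_carrier[of n] by (auto simp: Units_def ring_mat_def)
  then have "mat_inverse ?O \<noteq> None"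
    using mat_inverse(1)[OF obs_mat_carrier[of n], where b = "()"] by blast
  then have "mat_inverse ?O = Some obs_inv"
    by (simp add: obs_inv_def)
  from mat_inverse(2)[OF obs_mat_carrier[of n] this]
  show "?O * obs_inv = 1\<^sub>m n" "obs_inv * ?O = 1\<^sub>m n" "obs_inv \<in> carrier_mat n n" by auto
qed

lemma output_coeff_expand:
  assumes "j < n"
  shows "output_coeff t j = (\<Sum>l<n. state_coord t l * output_coeff l j)"
proof -
  let ?R = "c * A ^\<^sub>m t"
  have "(?R * obs_inv) * obs_mat A c n = ?R * (obs_inv * obs_mat A c n)"
    by (rule assoc_mult_mat[OF row_carrier obs_inv_carrier obs_mat_carrier])
  also have "\<dots> = ?R"
    unfolding obs_inv by (rule right_mult_one_mat[OF row_carrier])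
  finally have "output_coeff t j = ((?R * obs_inv) * obs_mat A c n) $$ (0, j)"
    by (simp add: output_coeff_def)
  also have "\<dots> = (\<Sum>l<n. (?R * obs_inv) $$ (0, l) * obs_mat A c n $$ (l, j))"
    using assms row_carrier[of t] obs_inv_carrier obs_mat_carrier[of n]
    by (intro index_mult_mat_sum[of _ 1 n _ n]) (auto intro: mult_carrier_mat)
  finally show ?thesis
    using assms by (simp add: state_coord_def obs_mat_index)
qed

lemma state_coord_initial:
  assumes "t < n" and "l < n"
  shows "state_coord t l = (if t = l then 1 else 0)"
proof -
  have "state_coord t l = (\<Sum>j<n. (c * A ^\<^sub>m t) $$ (0, j) * obs_inv $$ (j, l))"
    unfolding state_coord_def
    by (rule index_mult_mat_sum[OF row_carrier obs_inv_carrier]) (use assms in auto)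
  also have "\<dots> = (\<Sum>j<n. obs_mat A c n $$ (t, j) * obs_inv $$ (j, l))"
    using assms by (simp add: obs_mat_index output_coeff_def)
  also have "\<dots> = (obs_mat A c n * obs_inv) $$ (t, l)"
    by (rule index_mult_mat_sum[symmetric, OF obs_mat_carrier obs_inv_carrier assms])
  finally show ?thesis
    using assms by (simp add: obs_inv)
qed

lemma obs_minor_factor:
  assumes K: "\<beta> \<in> index_sets n k" and "length I = k"
  shows "minor output_coeff I (elems \<beta>)
    = (\<Sum>K\<in>index_sets n k. minor state_coord I (elems K) * minor output_coeff (elems K) (elems \<beta>))"
proof -
  note \<beta> = index_setsD[OF K]
  have "minor output_coeff I (elems \<beta>)
      = minor (\<lambda>t j. \<Sum>l<n. state_coord t l * output_coeff l j) I (elems \<beta>)"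
    using \<beta> assms by (intro minor_cong output_coeff_expand) auto
  also have "\<dots> = (\<Sum>K\<in>index_sets n (length I).
      minor state_coord I (elems K) * minor output_coeff (elems K) (elems \<beta>))"
    by (rule cauchy_binet) (use \<beta> assms in simp)
  finally show ?thesis using assms by simp
qed

text \<open>
  Write the rows of the observability matrix in the basis of its first \<open>n\<close> rows and apply
  Cauchy-Binet. The first \<open>m\<close> coordinate rows are unit vectors, so only the sets
  \<open>K \<supseteq> {..<m}\<close> contribute, and on these the coordinate minor reduces to one of order \<open>r\<close>.
\<close>

lemma obs_minor_prefix:
  assumes "\<beta> \<in> index_sets n (m + r)" and "m + r \<le> n"
  shows "minor output_coeff ([0..<m] @ [m + s..<m + s + r]) (elems \<beta>)
    = (\<Sum>J\<in>index_sets (n - m) r. minor (\<lambda>i j. state_coord (m + s + i) (m + j)) [0..<r] (elems J)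
        * minor output_coeff (elems ({..<m} \<union> (\<lambda>x. m + x) ` J)) (elems \<beta>))"
proof -
  let ?I = "[0..<m] @ [m + s..<m + s + r]"
  let ?e = "\<lambda>J. {..<m} \<union> (\<lambda>x. m + x) ` J"
  let ?f = "\<lambda>K. minor state_coord ?I (elems K) * minor output_coeff (elems K) (elems \<beta>)"
  have "minor output_coeff ?I (elems \<beta>) = (\<Sum>K\<in>index_sets n (m + r). ?f K)"
    by (rule obs_minor_factor) (use assms in auto)
  also have "\<dots> = (\<Sum>K\<in>?e ` index_sets (n - m) r. ?f K)"
  proof (rule sum.mono_neutral_right)
    show "?e ` index_sets (n - m) r \<subseteq> index_sets n (m + r)"
    proof
      fix K assume "K \<in> ?e ` index_sets (n - m) r"
      then obtain J where J: "J \<in> index_sets (n - m) r" "K = ?e J" by blast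
      note J' = index_setsD[OF J(1)]
      have "card K = card {..<m} + card ((\<lambda>x. m + x) ` J)"
        unfolding J(2) using J' by (intro card_Un_disjoint) auto
      also have "card ((\<lambda>x. m + x) ` J) = card J" by (rule card_image) auto
      finally have "card K = m + r" using J' by simp
      moreover have "K \<subseteq> {..<n}" using J J' assms(2) by auto
      ultimately show "K \<in> index_sets n (m + r)" by (simp add: index_sets_def)
    qed
    show "\<forall>K\<in>index_sets n (m + r) - ?e ` index_sets (n - m) r. ?f K = 0"
    proof
      fix K assume K: "K \<in> index_sets n (m + r) - ?e ` index_sets (n - m) r"
      then have K': "finite K" "card K = m + r" "K \<subseteq> {..<n}" by (auto dest: index_setsD)
      have "\<not> {..<m} \<subseteq> K"
      proof
        assume sub: "{..<m} \<subseteq> K"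
        define J where "J = (\<lambda>x. x - m) ` (K - {..<m})"
        have "card J = card (K - {..<m})"
          unfolding J_def by (intro card_image inj_onI) auto
        then have "card J = r" using sub K' by (simp add: card_Diff_subset)
        moreover have "J \<subseteq> {..<n - m}" using K' unfolding J_def by auto
        moreover have "(\<lambda>x. m + x) ` J = K - {..<m}"
          unfolding J_def image_image by (auto intro!: image_eqI)
        then have "K = ?e J" using sub by auto
        ultimately show False using K by (auto simp: index_sets_def)
      qed
      then obtain i where i: "i < m" "i \<notin> K" by auto
      have "minor state_coord ?I (elems K) = 0"
      proof (rule minor_zero_row)
        show "i \<in> set ?I" using i by simp
        fix j assume "j \<in> set (elems K)"
        then have "j < n" "i \<noteq> j" using K' i by auto
        then show "state_coord i j = 0" using i assms(2) by (simp add: state_coord_initial)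
      qed (use K' in simp)
      then show "?f K = 0" by simp
    qed
  qed (rule finite_index_sets)
  also have "\<dots> = (\<Sum>J\<in>index_sets (n - m) r. ?f (?e J))"
  proof (rule sum.reindex[unfolded comp_def], rule inj_onI)
    fix J J' assume "?e J = ?e J'"
    then have "?e J - {..<m} = ?e J' - {..<m}" by simp
    moreover have "?e J - {..<m} = (\<lambda>x. m + x) ` J" for J by auto
    ultimately show "J = J'" by (simp add: inj_image_eq_iff)
  qed
  also have "\<dots> = (\<Sum>J\<in>index_sets (n - m) r. minor (\<lambda>i j. state_coord (m + s + i) (m + j)) [0..<r] (elems J)
        * minor output_coeff (elems (?e J)) (elems \<beta>))"
  proof (intro sum.cong refl arg_cong2[where f = "(*)"])
    fix J assume J: "J \<in> index_sets (n - m) r"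
    note J' = index_setsD[OF J]
    have "minor state_coord ?I (elems (?e J)) = minor state_coord [m + s..<m + s + r] (map (\<lambda>x. m + x) (elems J))"
      unfolding elems_prefix_block[OF conjunct1[OF J']]
    proof (rule minor_unit_prefix)
      fix p q assume "p \<in> set [0..<m]" "q \<in> set [0..<m] \<union> set (map (\<lambda>x. m + x) (elems J))" "p \<noteq> q"
      moreover from this have "q < n" using J' assms(2) by auto
      ultimately show "state_coord p q = 0" using assms(2) by (simp add: state_coord_initial)
    qed (use J' assms(2) in \<open>auto simp: state_coord_initial\<close>)
    also have "\<dots> = minor state_coord (map (\<lambda>i. m + s + i) [0..<r]) (map (\<lambda>x. m + x) (elems J))"
      by (simp add: map_add_upt add.commute)
    also have "\<dots> = minor (\<lambda>i j. state_coord (m + s + i) (m + j)) [0..<r] (elems J)"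
      by (rule minor_map) (use J' in simp)
    finally show "minor state_coord ?I (elems (?e J)) = minor (\<lambda>i j. state_coord (m + s + i) (m + j)) [0..<r] (elems J)" .
  qed
  finally show ?thesis .
qed

lemma pow_add: "A ^\<^sub>m (i + j) = A ^\<^sub>m i * A ^\<^sub>m j"
proof (induction j)
  case (Suc j)
  then show ?case
    using A by (simp add: assoc_mult_mat[of _ n n _ n _ n])
qed (use A in simp)

text \<open>
  Multiplication by the inverse observability matrix passes to coordinates, and the factor
  \<open>(0, I)\<close> keeps the coordinates from number \<open>m\<close> on.
\<close>

lemma shifted_state_block:
  assumes "i < r" and "j < n - m"
  shows "(obs_mat A c r * A ^\<^sub>m s * (A ^\<^sub>m m * obs_inv * (0\<^sub>m m (n - m) @\<^sub>r 1\<^sub>m (n - m)))) $$ (i, j)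
    = state_coord (m + s + i) (m + j)" (is "(?O * ?S * (?M * obs_inv * ?E)) $$ _ = _")
proof -
  have nm: "m + (n - m) = n" using assms by simp
  have E: "?E \<in> carrier_mat n (n - m)"
    using carrier_append_rows[of "0\<^sub>m m (n - m)" m "n - m" "1\<^sub>m (n - m)" "n - m"] by (simp add: nm)
  have E_index: "?E $$ (l, j) = (if l = m + j then 1 else 0)" if "l < n" for l
    using that assms nm by (auto simp: append_rows_def)
  note carr = pow_carrier[of s] pow_carrier[of m] pow_carrier[of i] obs_inv_carrier E
    obs_mat_carrier[of r] row_carrier[of i] c
  let ?X = "?S * (?M * obs_inv * ?E)"
  have MI: "?M * obs_inv \<in> carrier_mat n n" and SM: "?S * ?M \<in> carrier_mat n n"
    and ME: "?M * obs_inv * ?E \<in> carrier_mat n (n - m)"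
    using carr by (meson mult_carrier_mat)+
  then have X: "?X \<in> carrier_mat n (n - m)"
    using carr by (meson mult_carrier_mat)
  have "?S * (?M * obs_inv * ?E) = ?S * (?M * obs_inv) * ?E"
    by (rule assoc_mult_mat[OF carr(1) MI E, symmetric])
  also have "?S * (?M * obs_inv) = ?S * ?M * obs_inv"
    by (rule assoc_mult_mat[OF carr(1,2,4), symmetric])
  finally have "c * A ^\<^sub>m i * ?X = c * A ^\<^sub>m i * (?S * ?M * obs_inv * ?E)" by simp
  also have "\<dots> = c * A ^\<^sub>m i * (?S * ?M * obs_inv) * ?E"
    by (rule assoc_mult_mat[OF carr(7) _ E, symmetric]) (use SM carr in \<open>meson mult_carrier_mat\<close>)
  also have "c * A ^\<^sub>m i * (?S * ?M * obs_inv) = c * A ^\<^sub>m i * (?S * ?M) * obs_inv"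
    by (rule assoc_mult_mat[OF carr(7) SM carr(4), symmetric])
  also have "c * A ^\<^sub>m i * (?S * ?M) = c * A ^\<^sub>m (i + (s + m))"
    unfolding pow_add by (rule assoc_mult_mat[OF c carr(3) SM])
  finally have row: "c * A ^\<^sub>m i * ?X = c * A ^\<^sub>m (i + (s + m)) * obs_inv * ?E" .
  have "?O * ?S * (?M * obs_inv * ?E) = ?O * ?X"
    by (rule assoc_mult_mat[OF carr(6,1) ME])
  then have "(?O * ?S * (?M * obs_inv * ?E)) $$ (i, j) = (?O * ?X) $$ (i, j)"
    by (rule arg_cong)
  also have "\<dots> = (\<Sum>l<n. ?O $$ (i, l) * ?X $$ (l, j))"
    by (rule index_mult_mat_sum[OF carr(6) X assms])
  also have "\<dots> = (\<Sum>l<n. (c * A ^\<^sub>m i) $$ (0, l) * ?X $$ (l, j))"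
    using assms by (simp add: obs_mat_index output_coeff_def)
  also have "\<dots> = (c * A ^\<^sub>m i * ?X) $$ (0, j)"
    by (rule index_mult_mat_sum[symmetric, OF carr(7) X _ assms(2)]) simp
  also have "\<dots> = (c * A ^\<^sub>m (i + (s + m)) * obs_inv * ?E) $$ (0, j)"
    unfolding row ..
  also have "\<dots> = (\<Sum>l<n. (c * A ^\<^sub>m (i + (s + m)) * obs_inv) $$ (0, l) * ?E $$ (l, j))"
    by (rule index_mult_mat_sum[of _ 1 n _ "n - m"])
      (use assms carr row_carrier[of "i + (s + m)"] in \<open>auto intro: mult_carrier_mat\<close>)
  also have "\<dots> = (\<Sum>l<n. if l = m + j then state_coord (i + (s + m)) l else 0)"
    by (intro sum.cong) (auto simp: E_index state_coord_def)
  also have "\<dots> = state_coord (m + s + i) (m + j)"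
    using assms by (simp add: ac_simps)
  finally show ?thesis .
qed

lemma P_mat_carrier: "\<beta> \<in> index_sets n k \<Longrightarrow> P_mat n \<beta> \<in> carrier_mat n k"
proof -
  assume "\<beta> \<in> index_sets n k"
  note \<beta> = index_setsD[OF this]
  then have "{j. j < n \<and> j \<in> \<beta>} = \<beta>" by auto
  then show ?thesis
    using \<beta> by (auto simp: P_mat_def submatrix_def)
qed

lemma obs_columns_index:
  assumes "\<beta> \<in> index_sets n k" and "i < n" and "j < k"
  shows "(obs_mat A c n * P_mat n \<beta>) $$ (i, j) = output_coeff i (elems \<beta> ! j)"
proof -
  note \<beta> = index_setsD[OF assms(1)]
  have "{j. j < n \<and> j \<in> \<beta>} = \<beta>" using \<beta> by auto
  note dim = P_mat_carrier[OF assms(1)]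
  have bj: "elems \<beta> ! j < n"
    using \<beta> assms(3) by (metis length_sorted_list_of_set lessThan_iff nth_mem set_sorted_list_of_set subsetD)
  have P: "P_mat n \<beta> $$ (l, j) = (if l = elems \<beta> ! j then 1 else 0)" if "l < n" for l
  proof -
    have "pick {..<n} l = l"
      using elems_nth_pick[of "{..<n}" l] that by (simp add: elems_lessThan)
    then show ?thesis
      using that \<beta> bj assms(3) \<open>{j. j < n \<and> j \<in> \<beta>} = \<beta>\<close>
      by (simp add: P_mat_def submatrix_def elems_nth_pick)
  qed
  have "(obs_mat A c n * P_mat n \<beta>) $$ (i, j) = (\<Sum>l<n. obs_mat A c n $$ (i, l) * P_mat n \<beta> $$ (l, j))"
    by (rule index_mult_mat_sum[OF obs_mat_carrier dim assms(2,3)])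
  also have "\<dots> = (\<Sum>l<n. if l = elems \<beta> ! j then output_coeff i l else 0)"
    using assms by (intro sum.cong) (auto simp: P obs_mat_index)
  also have "\<dots> = output_coeff i (elems \<beta> ! j)"
    using bj by simp
  finally show "(obs_mat A c n * P_mat n \<beta>) $$ (i, j) = output_coeff i (elems \<beta> ! j)" .
qed

text \<open>
  The output is a sum over all \<open>k\<close>-sets of rows, taken in lexicographic order, of which the zero
  block leaves the initial segment of sets containing \<open>{..<m}\<close>. By
  \<open>lex_index_sets_prefix\<close> this is the sum of \<open>obs_minor_prefix\<close>.
\<close>

lemma compound_system_output:
  assumes "\<beta> \<in> index_sets n (m + r)" and "m + r \<le> n" and "1 \<le> r"
  shows "(c_tilde A c r * A_tilde A r ^\<^sub>m s * b_tilde A c (m + r) r \<beta>) $$ (0, 0)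
    = minor output_coeff ([0..<m] @ [m + s..<m + s + r]) (elems \<beta>)"
proof -
  let ?k = "m + r" and ?n = "n - m"
  let ?E = "0\<^sub>m m ?n @\<^sub>r 1\<^sub>m ?n :: real mat"
  let ?B = "A ^\<^sub>m m * obs_inv * ?E"
  let ?W = "obs_mat A c n * P_mat n \<beta>"
  let ?O = "obs_mat A c r"
  let ?Z = "?O * A ^\<^sub>m s * ?B"
  let ?G = "append_cols (compound r ?B) (0\<^sub>m (n choose r) ((n choose ?k) - (?n choose r)))"
  have nm: "m + ?n = n" using assms by simp
  have "?E \<in> carrier_mat n ?n"
    using carrier_append_rows[of "0\<^sub>m m ?n" m ?n "1\<^sub>m ?n" ?n] by (simp add: nm)
  then have B: "?B \<in> carrier_mat n ?n"
    using pow_carrier[of m] obs_inv_carrier by (meson mult_carrier_mat)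
  have OA: "?O * A ^\<^sub>m s \<in> carrier_mat r n"
    using obs_mat_carrier pow_carrier by (meson mult_carrier_mat)
  then have Z: "?Z \<in> carrier_mat r ?n" using B by (meson mult_carrier_mat)
  have W: "?W \<in> carrier_mat n ?k"
    using P_mat_carrier[OF assms(1)] obs_mat_carrier by (auto intro!: mult_carrier_mat)
  have le: "?n choose r \<le> n choose ?k"
    using binomial_add_mono[of ?n r m] by (simp add: nm)
  have G: "?G \<in> carrier_mat (n choose r) (n choose ?k)"
    using compound_carrier[OF B, of r] le by (auto simp: append_cols_def)
  have b: "b_tilde A c ?k r \<beta> = ?G * compound ?k ?W"
    using A assms by (simp add: b_tilde_def obs_inv_def Let_def)
  have C: "compound r (?O * A ^\<^sub>m s) \<in> carrier_mat 1 (n choose r)"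
    using compound_carrier[OF OA, of r] by simp
  have Wk: "compound ?k ?W \<in> carrier_mat (n choose ?k) 1"
    using compound_carrier[OF W, of ?k] by simp
  \<comment> \<open>The zero columns of ?G cut off all but the first index sets.\<close>
  have CG: "(compound r (?O * A ^\<^sub>m s) * ?G) $$ (0, j) = (if j < ?n choose r then compound r ?Z $$ (0, j) else 0)"
    if "j < n choose ?k" for j
  proof -
    have "(compound r (?O * A ^\<^sub>m s) * ?G) $$ (0, j)
        = (\<Sum>l<n choose r. compound r (?O * A ^\<^sub>m s) $$ (0, l) * ?G $$ (l, j))"
      by (rule index_mult_mat_sum[OF C G]) (use that in auto)
    also have "\<dots> = (\<Sum>l<n choose r. if j < ?n choose r then compound r (?O * A ^\<^sub>m s) $$ (0, l) * compound r ?B $$ (l, j) else 0)"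
      using that le compound_carrier[OF B, of r] by (intro sum.cong) (auto simp: append_cols_def)
    also have "\<dots> = (if j < ?n choose r then (compound r (?O * A ^\<^sub>m s) * compound r ?B) $$ (0, j) else 0)"
      using index_mult_mat_sum[OF C compound_carrier[OF B, of r]] by simp
    finally show ?thesis using compound_mult[OF OA B, of r] by simp
  qed
  have "c_tilde A c r * A_tilde A r ^\<^sub>m s * b_tilde A c ?k r \<beta> = compound r (?O * A ^\<^sub>m s) * ?G * compound ?k ?W"
    unfolding c_tilde_def A_tilde_def b compound_mult_pow[OF obs_mat_carrier A]
    using C G Wk by (simp add: assoc_mult_mat[of _ 1 "n choose r" _ "n choose ?k" _ 1])
  then have "(c_tilde A c r * A_tilde A r ^\<^sub>m s * b_tilde A c ?k r \<beta>) $$ (0, 0)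
      = (compound r (?O * A ^\<^sub>m s) * ?G * compound ?k ?W) $$ (0, 0)"
    by (rule arg_cong)
  also have "\<dots> = (\<Sum>j<n choose ?k. (compound r (?O * A ^\<^sub>m s) * ?G) $$ (0, j) * compound ?k ?W $$ (j, 0))"
    by (rule index_mult_mat_sum[of _ 1 _ _ 1]) (use C G Wk in auto)
  also have "\<dots> = (\<Sum>j<n choose ?k. if j < ?n choose r then compound r ?Z $$ (0, j) * compound ?k ?W $$ (j, 0) else 0)"
    by (intro sum.cong) (auto simp: CG)
  also have "\<dots> = (\<Sum>j<?n choose r. compound r ?Z $$ (0, j) * compound ?k ?W $$ (j, 0))"
    using le by (intro sum.mono_neutral_cong_right) auto
  also have "\<dots> = (\<Sum>j<?n choose r. minor (\<lambda>i j. state_coord (m + s + i) (m + j)) [0..<r] (elems (lex_index_sets ?n r ! j))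
        * minor output_coeff (elems ({..<m} \<union> (\<lambda>x. m + x) ` (lex_index_sets ?n r ! j))) (elems \<beta>))"
  proof (intro sum.cong refl arg_cong2[where f = "(*)"])
    fix j assume "j \<in> {..<?n choose r}"
    then have j: "j < ?n choose r" by simp
    let ?J = "lex_index_sets ?n r ! j"
    have J: "finite ?J" "card ?J = r" "?J \<subseteq> {..<?n}" using index_setsD[OF lex_index_sets_nth[OF j]] by auto
    have full: "lex_index_sets p p ! 0 = {..<p}" for p
    proof -
      have "lex_index_sets p p ! 0 \<in> index_sets p p" by (rule lex_index_sets_nth) simp
      then show ?thesis by (intro card_subset_eq) (auto simp: index_sets_def)
    qed
    have "compound r ?Z $$ (0, j) = minor (\<lambda>i j. ?Z $$ (i, j)) [0..<r] (elems ?J)"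
      using compound_index[OF Z, of 0 r j] j by (simp add: full elems_lessThan)
    also have "\<dots> = minor (\<lambda>i j. state_coord (m + s + i) (m + j)) [0..<r] (elems ?J)"
      using J by (intro minor_cong shifted_state_block) auto
    finally show "compound r ?Z $$ (0, j) = minor (\<lambda>i j. state_coord (m + s + i) (m + j)) [0..<r] (elems ?J)" .
    let ?K = "{..<m} \<union> (\<lambda>x. m + x) ` ?J"
    have K: "lex_index_sets n ?k ! j = ?K"
      using lex_index_sets_prefix[OF j, of m] by (simp add: nm)
    have "j < n choose ?k" using j le by simp
    then have KI: "?K \<in> index_sets n ?k" unfolding K[symmetric] by (rule lex_index_sets_nth)
    have "compound ?k ?W $$ (j, 0) = minor (\<lambda>i j. ?W $$ (i, j)) (elems ?K) [0..<?k]"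
      using compound_index[OF W, of j ?k 0] \<open>j < n choose ?k\<close> by (simp add: full elems_lessThan K)
    also have "\<dots> = minor (\<lambda>i j. output_coeff i (elems \<beta> ! j)) (elems ?K) [0..<?k]"
      using index_setsD[OF KI] by (intro minor_cong obs_columns_index[OF assms(1)]) auto
    also have "\<dots> = minor output_coeff (map (\<lambda>i. i) (elems ?K)) (map (\<lambda>j. elems \<beta> ! j) [0..<?k])"
      by (rule minor_map[symmetric]) (use index_setsD[OF KI] in simp)
    also have "map (\<lambda>j. elems \<beta> ! j) [0..<?k] = elems \<beta>"
      using map_nth[of "elems \<beta>"] index_setsD[OF assms(1)] by simp
    finally show "compound ?k ?W $$ (j, 0) = minor output_coeff (elems ?K) (elems \<beta>)" by simp
  qed
  also have "\<dots> = (\<Sum>J\<in>index_sets ?n r. minor (\<lambda>i j. state_coord (m + s + i) (m + j)) [0..<r] (elems J)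
        * minor output_coeff (elems ({..<m} \<union> (\<lambda>x. m + x) ` J)) (elems \<beta>))"
    by (rule sum_lex_index_sets)
  also have "\<dots> = minor output_coeff ([0..<m] @ [m + s..<m + s + r]) (elems \<beta>)"
    by (rule obs_minor_prefix[symmetric, OF assms(1,2)])
  finally show ?thesis .
qed

lemma det_obs_submatrix:
  assumes "\<alpha> \<in> index_sets N k" and "\<beta> \<in> index_sets n k"
  shows "det (submatrix (obs_mat A c N) \<alpha> \<beta>) = minor output_coeff (elems \<alpha>) (elems \<beta>)"
proof -
  note \<alpha>\<beta> = index_setsD[OF assms(1)] index_setsD[OF assms(2)]
  have "det (submatrix (obs_mat A c N) \<alpha> \<beta>) = minor (\<lambda>i j. obs_mat A c N $$ (i, j)) (elems \<alpha>) (elems \<beta>)"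
    using \<alpha>\<beta> obs_mat_carrier[of N] by (intro det_submatrix) auto
  also have "\<dots> = minor output_coeff (elems \<alpha>) (elems \<beta>)"
    using \<alpha>\<beta> by (intro minor_cong obs_mat_index) auto
  finally show ?thesis .
qed

end

section \<open>Sign changes\<close>

lemma mult_sign_trans:
  fixes w x y :: real
  shows "w * x > 0 \<Longrightarrow> w * y > 0 \<Longrightarrow> x * y > 0"
    and "w * x > 0 \<Longrightarrow> x * y > 0 \<Longrightarrow> w * y > 0"
    and "w * x > 0 \<Longrightarrow> x * y < 0 \<Longrightarrow> w * y < 0"
    and "w * x > 0 \<Longrightarrow> w * y < 0 \<Longrightarrow> x * y < 0"
  by (auto simp: zero_less_mult_iff mult_less_0_iff)

text \<open>
  The number of sign changes completed up to position \<open>i\<close>. It starts at \<open>0\<close>, is monotone and grows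
  by at most one per step, hence attains all values in between; its parity determines the sign of
  the entry at \<open>i\<close>.
\<close>

definition change_count :: "nat set \<Rightarrow> (nat \<Rightarrow> real) \<Rightarrow> nat \<Rightarrow> nat" where
  "change_count D v i = card {pq \<in> sign_change_pairs D v. snd pq \<le> i}"

lemma finite_changes_upto: "finite {pq \<in> sign_change_pairs D v. snd pq \<le> i}"
  by (rule finite_subset[of _ "{..i} \<times> {..i}"]) (auto simp: sign_change_pairs_def)

lemma change_count_mono: "i \<le> j \<Longrightarrow> change_count D v i \<le> change_count D v j"
  unfolding change_count_def by (rule card_mono[OF finite_changes_upto]) auto

lemma change_count_no_pred:
  assumes "\<And>p. p \<in> D \<Longrightarrow> i \<le> p"
  shows "change_count D v i = 0"
proof -
  have "{pq \<in> sign_change_pairs D v. snd pq \<le> i} = {}"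
    using assms by (fastforce simp: sign_change_pairs_def)
  then show ?thesis
    unfolding change_count_def by (simp only: card.empty)
qed

lemma change_count_pred:
  assumes "p \<in> D" "i \<in> D" "p < i" and between: "\<And>l. l \<in> D \<Longrightarrow> p < l \<Longrightarrow> l < i \<Longrightarrow> False"
  shows "change_count D v i = change_count D v p + (if v p * v i < 0 then 1 else 0)"
proof -
  let ?C = "\<lambda>i. {pq \<in> sign_change_pairs D v. snd pq \<le> i}"
  have "?C i = ?C p \<union> (if v p * v i < 0 then {(p, i)} else {})"
  proof (intro equalityI subsetI)
    fix x assume x: "x \<in> ?C i"
    obtain a b where ab: "x = (a, b)" by fastforce
    have m: "a \<in> D" "b \<in> D" "a < b" "\<And>l. l \<in> D \<Longrightarrow> a < l \<Longrightarrow> l < b \<Longrightarrow> False" "v a * v b < 0" "b \<le> i"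
      using x by (auto simp: ab sign_change_pairs_def)
    show "x \<in> ?C p \<union> (if v p * v i < 0 then {(p, i)} else {})"
    proof (cases "b \<le> p")
      case True
      then show ?thesis using x by (simp add: ab)
    next
      case False
      then have "b = i" using m between[of b] by force
      then have "a = p" using m(4)[of p] between[of a] m(1,3) False assms by force
      then show ?thesis using \<open>b = i\<close> m by (simp add: ab)
    qed
  next
    fix x assume "x \<in> ?C p \<union> (if v p * v i < 0 then {(p, i)} else {})"
    then show "x \<in> ?C i"
      using assms by (auto simp: sign_change_pairs_def split: if_splits)
  qed
  then show ?thesis
    using finite_changes_upto[of D v p] \<open>p < i\<close> by (simp add: change_count_def)
qed

lemma change_count_Suc: "change_count D v (Suc i) \<le> Suc (change_count D v i)"
proof -
  let ?C = "\<lambda>i. {pq \<in> sign_change_pairs D v. snd pq \<le> i}"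
  let ?N = "{pq \<in> sign_change_pairs D v. snd pq = Suc i}"
  have "x = y" if "x \<in> ?N" "y \<in> ?N" for x y
    using that by (cases x; cases y) (auto simp: sign_change_pairs_def, metis nat_neq_iff)
  then have "card ?N \<le> 1"
    by (metis (no_types, lifting) One_nat_def card_le_Suc0_iff_eq finite_changes_upto finite_subset order_refl Collect_mono_iff card.infinite zero_le_one)
  moreover have "?C (Suc i) = ?C i \<union> ?N" by auto
  then have "card (?C (Suc i)) \<le> card (?C i) + card ?N"
    by (simp add: card_Un_le)
  ultimately show ?thesis by (simp add: change_count_def)
qed

text \<open>
  Between an element of \<open>D\<close> and its predecessor the sign flips exactly when the count increases.
\<close>

lemma sign_by_change_count:
  assumes nz: "\<And>i. i \<in> D \<Longrightarrow> v i \<noteq> 0" and d: "d \<in> D" "\<And>i. i \<in> D \<Longrightarrow> d \<le> i"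
    and "i \<in> D"
  shows "v d * (-1) ^ change_count D v i * v i > 0"
  using \<open>i \<in> D\<close>
proof (induction i rule: less_induct)
  case (less i)
  show ?case
  proof (cases "i = d")
    case True
    have "v d * v d > 0"
      using nz[OF d(1)] by (metis not_real_square_gt_zero)
    then show ?thesis
      using d True by (simp add: change_count_no_pred)
  next
    case False
    let ?P = "{l \<in> D. l < i}"
    have P: "finite ?P" "?P \<noteq> {}"
      using d less.prems False by (auto simp: nat_less_le)
    define p where "p = Max ?P"
    have p: "p \<in> D" "p < i" and between: "\<And>l. l \<in> D \<Longrightarrow> p < l \<Longrightarrow> l < i \<Longrightarrow> False"
      using Max_in[OF P] Max_ge[OF P(1)] by (auto simp: p_def not_less[symmetric])
    have IH: "v d * (-1) ^ change_count D v p * v p > 0"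
      using less.IH p by blast
    have count: "change_count D v i = change_count D v p + (if v p * v i < 0 then 1 else 0)"
      by (rule change_count_pred) (use p less.prems between in auto)
    have "v p * v i \<noteq> 0" using nz p less.prems by simp
    then consider "v p * v i < 0" | "v p * v i > 0" by linarith
    then show ?thesis
    proof cases
      case 1
      then show ?thesis
        using mult_sign_trans(3)[OF IH 1] by (simp add: count)
    next
      case 2
      then show ?thesis
        using mult_sign_trans(2)[OF IH 2] by (simp add: count)
    qed
  qed
qed

lemma sign_changes_le_iff:
  "sign_changes D v \<le> ereal (real m) \<longleftrightarrow> finite (sign_change_pairs D v) \<and> card (sign_change_pairs D v) \<le> m"
  by (simp add: sign_changes_def)

lemma change_count_le_card:
  "finite (sign_change_pairs D v) \<Longrightarrow> change_count D v i \<le> card (sign_change_pairs D v)"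
  unfolding change_count_def by (rule card_mono) auto

lemma change_count_unbounded:
  assumes "\<not> sign_changes D v \<le> ereal (real m)"
  obtains i where "Suc m \<le> change_count D v i"
proof -
  obtain F where F: "F \<subseteq> sign_change_pairs D v" "finite F" "card F = Suc m"
    using assms unfolding sign_changes_le_iff
    by (metis (no_types, lifting) infinite_arbitrarily_large not_less_eq_eq obtain_subset_with_card_n)
  have "F \<subseteq> {pq \<in> sign_change_pairs D v. snd pq \<le> Max (snd ` F)}"
  proof
    fix x assume "x \<in> F"
    then have "snd x \<le> Max (snd ` F)" using F(2) by (intro Max_ge) simp_all
    with \<open>x \<in> F\<close> F(1) show "x \<in> {pq \<in> sign_change_pairs D v. snd pq \<le> Max (snd ` F)}" by blast
  qed
  then have "card F \<le> change_count D v (Max (snd ` F))"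
    unfolding change_count_def by (rule card_mono[OF finite_changes_upto])
  then show thesis unfolding F(3) by (rule that)
qed

lemma discrete_intermediate_value:
  fixes f :: "nat \<Rightarrow> nat"
  assumes "f 0 = 0" and "\<And>i. f (Suc i) \<le> Suc (f i)" and "q \<le> f N"
  shows "\<exists>i\<le>N. f i = q"
  using \<open>q \<le> f N\<close>
proof (induction N)
  case 0
  then show ?case using assms(1) by auto
next
  case (Suc N)
  show ?case
  proof (cases "q \<le> f N")
    case True
    then show ?thesis using Suc.IH le_Suc_eq by blast
  next
    case False
    then have "f (Suc N) = q" using Suc.prems assms(2)[of N] by linarith
    then show ?thesis by blast
  qed
qed

subsection \<open>Weak alternation\<close>

text \<open>
  Entries of alternating sign, where zeros may take either sign. Longest such subsequences are what
  \<open>S_plus\<close> measures, without choosing replacements for zeros.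
\<close>

definition weakly_alternating :: "(nat \<Rightarrow> real) \<Rightarrow> nat list \<Rightarrow> bool" where
  "weakly_alternating z I \<longleftrightarrow> (\<exists>s. s \<noteq> 0 \<and> (\<forall>j<length I. s * (-1) ^ j * z (I ! j) \<ge> 0))"

text \<open>
  Choose one position for each value \<open>0, \<dots>, m + 1\<close> of the change count of a zero-free completion
  \<open>v\<close>. There \<open>v\<close> alternates strictly, and \<open>z\<close> either agrees with \<open>v\<close> or vanishes.
\<close>

lemma weakly_alternating_if_S_plus:
  assumes "\<not> S_plus UNIV z \<le> ereal (real m)"
  obtains I where "sorted_wrt (<) I" and "length I = m + 2" and "weakly_alternating z I"
proof -
  let ?V = "{v. \<forall>i\<in>UNIV. v i \<noteq> 0 \<and> (z i \<noteq> 0 \<longrightarrow> v i = z i)}"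
  have "\<exists>v\<in>?V. \<not> sign_changes UNIV v \<le> ereal (real m)"
  proof (rule ccontr)
    assume "\<not> (\<exists>v\<in>?V. \<not> sign_changes UNIV v \<le> ereal (real m))"
    then have "S_plus UNIV z \<le> ereal (real m)"
      unfolding S_plus_def by (intro SUP_least) blast
    then show False using assms by contradiction
  qed
  then obtain v where v: "\<And>i. v i \<noteq> 0" "\<And>i. z i \<noteq> 0 \<Longrightarrow> v i = z i" and "\<not> sign_changes UNIV v \<le> ereal (real m)"
    by blast
  then obtain N where N: "Suc m \<le> change_count UNIV v N"
    using change_count_unbounded by blast
  let ?g = "change_count UNIV v"
  have "\<exists>i. ?g i = j" if "j \<le> Suc m" for j
  proof -
    have "\<exists>i\<le>N. ?g i = j"
    proof (rule discrete_intermediate_value)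
      show "?g 0 = 0" by (rule change_count_no_pred) simp
      show "j \<le> ?g N" using that N by (rule le_trans)
    qed (rule change_count_Suc)
    then show ?thesis by blast
  qed
  then obtain f where f: "\<And>j. j \<le> Suc m \<Longrightarrow> ?g (f j) = j"
    by metis
  have strict: "f i < f j" if "i < j" "j < m + 2" for i j
  proof (rule ccontr)
    assume "\<not> f i < f j"
    then have "?g (f j) \<le> ?g (f i)" by (intro change_count_mono) simp
    then show False using that f[of i] f[of j] by simp
  qed
  let ?I = "map f [0..<m + 2]"
  show thesis
  proof (rule that)
    show "sorted_wrt (<) ?I"
      using strict by (auto simp: sorted_wrt_iff_nth_less simp del: upt_Suc)
    show "weakly_alternating z ?I"
      unfolding weakly_alternating_def
    proof (intro exI[of _ "v 0"] conjI allI impI)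
      fix j assume "j < length ?I"
      then have j: "j \<le> Suc m" by simp
      have "v 0 * (-1) ^ ?g (f j) * v (f j) > 0"
        by (rule sign_by_change_count) (use v in auto)
      then have "v 0 * (-1) ^ j * z (f j) \<ge> 0"
        using f[OF j] v(2)[of "f j"] by (cases "z (f j) = 0") auto
      then show "v 0 * (-1) ^ j * z (?I ! j) \<ge> 0" using j by (simp del: upt_Suc)
    qed (use v in simp)
  qed simp
qed

text \<open>
  Replace the zeros on \<open>I\<close> according to the alternating pattern and all others by \<open>1\<close>. The change
  count must then increase from every element of \<open>I\<close> to the next.
\<close>

lemma S_plus_if_weakly_alternating:
  assumes I: "sorted_wrt (<) I" "length I = m + 2" and "weakly_alternating z I"
  shows "\<not> S_plus UNIV z \<le> ereal (real m)"
proof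
  assume le: "S_plus UNIV z \<le> ereal (real m)"
  obtain s where s: "s \<noteq> 0" "\<And>j. j < m + 2 \<Longrightarrow> s * (-1) ^ j * z (I ! j) \<ge> 0"
    using assms by (auto simp: weakly_alternating_def)
  define v where "v i = (if z i \<noteq> 0 then z i
    else if i \<in> set I then s * (-1) ^ (SOME j. j < length I \<and> I ! j = i) else 1)" for i
  have nz: "v i \<noteq> 0" for i using s by (simp add: v_def)
  have pos: "s * (-1) ^ j * v (I ! j) > 0" if j: "j < m + 2" for j
  proof (cases "z (I ! j) = 0")
    case True
    have "distinct I" using I strict_sorted_iff by blast
    then have "(SOME i. i < length I \<and> I ! i = I ! j) = j"
      using j I by (intro some_equality) (auto simp: nth_eq_iff_index_eq)
    moreover have "I ! j \<in> set I" using j I by simp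
    ultimately have "v (I ! j) = s * (-1) ^ j" using True by (simp add: v_def)
    moreover have "s * s > 0" using s(1) by (metis not_real_square_gt_zero)
    ultimately show ?thesis by (simp add: ac_simps power_mult_distrib[symmetric])
  next
    case False
    then have "s * (-1) ^ j * z (I ! j) \<noteq> 0" using s(1) by simp
    moreover have "v (I ! j) = z (I ! j)" using False by (simp add: v_def)
    ultimately show ?thesis using s(2)[OF j] by (metis order_le_less)
  qed
  have "sign_changes UNIV v \<le> S_plus UNIV z"
    unfolding S_plus_def by (rule SUP_upper) (use nz in \<open>auto simp: v_def\<close>)
  then have "sign_changes UNIV v \<le> ereal (real m)" using le by (rule order_trans)
  then have fin: "finite (sign_change_pairs UNIV v)" "card (sign_change_pairs UNIV v) \<le> m"
    by (simp_all add: sign_changes_le_iff)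
  let ?g = "change_count UNIV v"
  have "j \<le> ?g (I ! j)" if "j < m + 2" for j
    using that
  proof (induction j)
    case (Suc j)
    have "I ! j < I ! Suc j" using I Suc.prems by (simp add: sorted_wrt_iff_nth_less)
    then have "?g (I ! j) \<le> ?g (I ! Suc j)" by (intro change_count_mono) simp
    moreover have "?g (I ! j) \<noteq> ?g (I ! Suc j)"
    proof
      assume eq: "?g (I ! j) = ?g (I ! Suc j)"
      have "v 0 * (-1) ^ ?g (I ! j) * v (I ! j) > 0" "v 0 * (-1) ^ ?g (I ! Suc j) * v (I ! Suc j) > 0"
        by (rule sign_by_change_count, use nz in auto)+
      then have "v (I ! j) * v (I ! Suc j) > 0"
        unfolding eq by (rule mult_sign_trans(1))
      moreover have "s * (-1) ^ j * v (I ! j) > 0" "s * (-1) ^ j * v (I ! Suc j) < 0"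
        using pos[of j] pos[of "Suc j"] Suc.prems by auto
      then have "v (I ! j) * v (I ! Suc j) < 0"
        by (rule mult_sign_trans(4))
      ultimately show False by simp
    qed
    ultimately show ?case using Suc by simp
  qed simp
  from this[of "Suc m"] have "Suc m \<le> ?g (I ! Suc m)" by simp
  also have "\<dots> \<le> m" using change_count_le_card[OF fin(1)] fin(2) le_trans by blast
  finally show False by simp
qed

subsection \<open>Small support and blocks\<close>

lemma change_count_list:
  assumes L: "sorted_wrt (<) L" and "Suc j < length L"
  shows "change_count (set L) u (L ! Suc j)
    = change_count (set L) u (L ! j) + (if u (L ! j) * u (L ! Suc j) < 0 then 1 else 0)"
proof (rule change_count_pred)
  show "L ! j < L ! Suc j" using assms by (simp add: sorted_wrt_iff_nth_less)
  fix l assume l: "l \<in> set L" "L ! j < l" "l < L ! Suc j"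
  then obtain i where i: "i < length L" "l = L ! i" by (metis in_set_conv_nth)
  then have "\<not> i \<le> j" "\<not> Suc j \<le> i"
    using l assms by (metis sorted_wrt_iff_nth_less le_neq_implies_less less_asym less_irrefl Suc_lessD)+
  then show False by simp
qed (use assms in auto)

lemma change_count_hd:
  assumes "sorted_wrt (<) L" and "L \<noteq> []"
  shows "change_count (set L) u (L ! 0) = 0"
  using assms by (intro change_count_no_pred) (cases L; auto intro: less_imp_le)

lemma change_count_list_le:
  assumes L: "sorted_wrt (<) L" and "i \<le> j" and "j < length L"
  shows "change_count (set L) u (L ! j) \<le> change_count (set L) u (L ! i) + (j - i)"
  using \<open>i \<le> j\<close> \<open>j < length L\<close>
proof (induction j rule: dec_induct)
  case (step j)
  then show ?case using change_count_list[OF L, of j u] by (simp split: if_splits)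
qed simp

lemma card_sign_change_pairs_list:
  assumes "sorted_wrt (<) L" and "L \<noteq> []"
  shows "finite (sign_change_pairs (set L) u)"
    and "card (sign_change_pairs (set L) u) = change_count (set L) u (L ! (length L - 1))"
proof -
  have "x \<le> L ! (length L - 1)" if x: "x \<in> set L" for x
  proof -
    obtain i where "i < length L" "x = L ! i" using x by (metis in_set_conv_nth)
    then have "i = length L - 1 \<or> i < length L - 1" by linarith
    then show ?thesis
      using assms \<open>x = L ! i\<close> by (auto simp: sorted_wrt_iff_nth_less intro: less_imp_le)
  qed
  then have "sign_change_pairs (set L) u = {pq \<in> sign_change_pairs (set L) u. snd pq \<le> L ! (length L - 1)}"
    by (auto simp: sign_change_pairs_def)
  then show "finite (sign_change_pairs (set L) u)"
    "card (sign_change_pairs (set L) u) = change_count (set L) u (L ! (length L - 1))"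
    unfolding change_count_def by (metis finite_changes_upto, rule arg_cong)
qed

lemma S_minus_small_support:
  assumes "sorted_wrt (<) L" and "{i \<in> {..<n}. u i \<noteq> 0} \<subseteq> set L" and "length L = Suc m"
  shows "S_minus {..<n} u \<le> ereal (real m)"
proof (cases "\<forall>i\<in>{..<n}. u i = 0")
  case True
  then show ?thesis by (simp add: S_minus_def one_ereal_def)
next
  case False
  define D where "D = {i \<in> {..<n}. u i \<noteq> 0}"
  let ?E = "elems D"
  have D: "finite D" "D \<noteq> {}" "D \<subseteq> set L" using False assms by (auto simp: D_def)
  have E: "sorted_wrt (<) ?E" "?E \<noteq> []" "set ?E = D" using D by auto
  have "length ?E \<le> Suc m"
    using card_mono[OF _ D(3)] card_length[of L] assms by simp
  then have "change_count (set ?E) u (?E ! (length ?E - 1)) \<le> m"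
    using change_count_list_le[OF E(1), of 0 "length ?E - 1" u] change_count_hd[OF E(1,2), of u]
      length_greater_0_conv[of ?E] E(2) by linarith
  then have "sign_changes D u \<le> ereal (real m)"
    using card_sign_change_pairs_list[OF E(1,2), of u] E(3) by (simp add: sign_changes_le_iff)
  then show ?thesis unfolding S_minus_def D_def using False by (simp only: if_False)
qed

text \<open>
  Among \<open>m + 2\<close> nonzero entries there are \<open>m + 1\<close> neighbouring pairs, so more than \<open>m\<close> sign changes
  force a change at every one of them.
\<close>

lemma alternating_if_S_minus:
  assumes L: "sorted_wrt (<) L" and supp: "{i \<in> {..<n}. u i \<noteq> 0} = set L" and len: "length L = m + 2"
    and S: "\<not> S_minus {..<n} u \<le> ereal (real m)" and j: "j < m + 2"
  shows "u (L ! 0) * (-1) ^ j * u (L ! j) > 0"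
proof -
  let ?D = "set L"
  have ne: "L \<noteq> []" using len by auto
  then have "L ! 0 \<in> {i \<in> {..<n}. u i \<noteq> 0}" unfolding supp by simp
  then have "\<not> (\<forall>i\<in>{..<n}. u i = 0)" by blast
  then have "\<not> sign_changes ?D u \<le> ereal (real m)"
    using S unfolding S_minus_def supp by (simp only: if_False simp_thms)
  then have "Suc m \<le> change_count ?D u (L ! Suc m)"
    using card_sign_change_pairs_list[OF L ne, of u] len by (auto simp: sign_changes_le_iff)
  also have "\<dots> \<le> change_count ?D u (L ! j) + (Suc m - j)"
    by (rule change_count_list_le[OF L]) (use j len in auto)
  finally have "j \<le> change_count ?D u (L ! j)" using j by simp
  moreover have "change_count ?D u (L ! j) \<le> j"
    using change_count_list_le[OF L, of 0 j u] change_count_hd[OF L ne, of u] j len by simp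
  ultimately have count: "change_count ?D u (L ! j) = j" by simp
  have "u (L ! 0) * (-1) ^ change_count ?D u (L ! j) * u (L ! j) > 0"
  proof (rule sign_by_change_count)
    show "u i \<noteq> 0" if "i \<in> ?D" for i using that supp by blast
    show "L ! 0 \<le> i" if "i \<in> ?D" for i
      using that L by (cases L) (auto intro: less_imp_le)
  qed (use j len ne in auto)
  then show ?thesis by (simp add: count)
qed

text \<open>
  The change count numbers the maximal blocks of constant sign. There are at most \<open>m + 1\<close> of them; if there
  are fewer, some have to be split, which is possible because there are at least \<open>m + 1\<close> positions.
\<close>

lemma S_minus_blocks:
  assumes S: "S_minus {..<n} u \<le> ereal (real m)" and nz: "\<not> (\<forall>i\<in>{..<n}. u i = 0)" and n: "Suc m \<le> n"
  obtains b :: "nat \<Rightarrow> nat" where "mono b" and "b ` {..<n} = {..<Suc m}"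
    and "\<And>i j. i < n \<Longrightarrow> j < n \<Longrightarrow> b i = b j \<Longrightarrow> u i * u j \<ge> 0"
proof -
  define D where "D = {i \<in> {..<n}. u i \<noteq> 0}"
  let ?g = "change_count D u"
  have "sign_changes D u \<le> ereal (real m)"
    using S nz unfolding S_minus_def D_def by (simp only: if_False)
  then have g_le: "?g i \<le> m" for i
    using change_count_le_card[of D u i] by (simp add: sign_changes_le_iff)
  \<comment> \<open>The second argument of max splits off single positions at the end, as late as possible, until
      all m + 1 block numbers occur; b i = b j still implies ?g i = ?g j.\<close>
  define b where "b i = max (?g i) (i - (n - Suc m))" for i
  have b_Suc: "b (Suc i) \<le> Suc (b i)" for i
    using change_count_Suc[of D u i] by (auto simp: b_def)
  have b_0: "b 0 = 0" by (simp add: b_def change_count_no_pred)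
  have g_eq: "?g i = ?g j" if "i < j" "b i = b j" for i j
    using that change_count_mono[of i j D u] by (auto simp: b_def max_def split: if_splits)
  have sign: "u i * u j \<ge> 0" if "i < j" "j < n" "b i = b j" for i j
  proof (cases "i \<in> D \<and> j \<in> D")
    case True
    define d where "d = Min D"
    have "finite D" "D \<noteq> {}" using True by (auto simp: D_def)
    then have d: "d \<in> D" "\<And>i. i \<in> D \<Longrightarrow> d \<le> i" by (simp_all add: d_def)
    have "u d * (-1) ^ ?g i * u i > 0" "u d * (-1) ^ ?g j * u j > 0"
      by (rule sign_by_change_count; use d True in \<open>auto simp: D_def\<close>)+
    then show ?thesis
      unfolding g_eq[OF that(1,3)] using mult_sign_trans(1) by (meson less_imp_le)
  next
    case False
    then show ?thesis using that by (auto simp: D_def)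
  qed
  show thesis
  proof (rule that)
    show "mono b"
      by (rule monoI) (auto simp: b_def max_def dest: change_count_mono[of _ _ D u])
    show "b ` {..<n} = {..<Suc m}"
    proof (intro equalityI subsetI)
      fix q assume "q \<in> {..<Suc m}"
      then have "q \<le> b (n - 1)" using n by (auto simp: b_def)
      then obtain i where "i \<le> n - 1" "b i = q"
        using discrete_intermediate_value[of b q "n - 1"] b_0 b_Suc by blast
      then show "q \<in> b ` {..<n}" using n by (intro image_eqI) auto
    qed (use g_le n in \<open>auto simp: b_def less_Suc_eq_le\<close>)
    show "u i * u j \<ge> 0" if "i < n" "j < n" "b i = b j" for i j
      using sign[of i j] sign[of j i] that by (cases i j rule: linorder_cases) (auto simp: mult.commute)
  qed
qed

section \<open>Sign-consistent minors bound the variation\<close>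

text \<open>
  The positivity test for Pluecker coordinates is applied twice: to the rows, for fixed initial columns,
  and then to the columns, for arbitrary rows. The factor \<open>\<sigma>\<close> covers both signs at once, because the
  three-term relation is quadratic.
\<close>

lemma all_minors_positive:
  fixes X :: "nat \<Rightarrow> nat \<Rightarrow> real"
  assumes initial: "\<And>p s q s'. p < k \<Longrightarrow> p \<le> s \<Longrightarrow> q < k \<Longrightarrow> q \<le> s' \<Longrightarrow> s' + (k - q) \<le> n \<Longrightarrow>
      \<sigma> * minor X (elems ({..<p} \<union> {s..<s + (k - p)})) (elems ({..<q} \<union> {s'..<s' + (k - q)})) > 0"
    and k: "1 \<le> k" and \<alpha>: "finite \<alpha>" "card \<alpha> = k" and \<beta>: "\<beta> \<in> index_sets n k"
  shows "\<sigma> * minor X (elems \<alpha>) (elems \<beta>) > 0"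
proof -
  have scale: "(\<sigma> * a) * (\<sigma> * b) = (\<sigma> * c) * (\<sigma> * d) + (\<sigma> * e) * (\<sigma> * f)"
    if "a * b = c * d + e * f" for a b c d e f
  proof -
    have "(\<sigma> * a) * (\<sigma> * b) = \<sigma> * \<sigma> * (a * b)" by (simp add: ac_simps)
    then show ?thesis unfolding that by (simp add: algebra_simps)
  qed
  define N where "N = Suc (Max \<alpha>)"
  have "\<alpha> \<in> index_sets N k"
    using \<alpha> by (auto simp: index_sets_def N_def less_Suc_eq_le)
  show ?thesis
  proof (rule pluecker_positive[of n k "\<lambda>\<beta>. \<sigma> * minor X (elems \<alpha>) (elems \<beta>)", OF _ _ k \<beta>])
    fix S a b c d
    assume S: "finite S" "S \<subseteq> {..<n}" "card S + 2 = k" "a < b" "b < c" "c < d" "d < n"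
      "a \<notin> S" "b \<notin> S" "c \<notin> S" "d \<notin> S"
    have T: "minor X (elems \<alpha>) (elems (S \<union> {x, y})) = minor (\<lambda>i j. X j i) (elems (S \<union> {x, y})) (elems \<alpha>)"
      if "x \<notin> S" "y \<notin> S" "x < y" for x y
      using that S \<alpha> by (intro minor_transpose) simp
    have "length (elems \<alpha>) = card S + 2" using S \<alpha> by simp
    note rel = pluecker_relation[OF S(1) this S(4-6,8-11), of "\<lambda>i j. X j i"]
    show "\<sigma> * minor X (elems \<alpha>) (elems (S \<union> {a, c})) * (\<sigma> * minor X (elems \<alpha>) (elems (S \<union> {b, d})))
      = \<sigma> * minor X (elems \<alpha>) (elems (S \<union> {a, b})) * (\<sigma> * minor X (elems \<alpha>) (elems (S \<union> {c, d})))
        + \<sigma> * minor X (elems \<alpha>) (elems (S \<union> {a, d})) * (\<sigma> * minor X (elems \<alpha>) (elems (S \<union> {b, c})))"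
      using S by (intro scale) (simp only: T rel less_trans[of a b c] less_trans[of b c d] less_trans[of a b d] not_False_eq_True)
  next
    fix q s' assume q: "q < k" "q \<le> s'" "s' + (k - q) \<le> n"
    let ?\<beta> = "{..<q} \<union> {s'..<s' + (k - q)}"
    have "card ?\<beta> = card {..<q} + card {s'..<s' + (k - q)}"
      using q by (intro card_Un_disjoint) auto
    then have card: "card ?\<beta> = k" using q by simp
    show "\<sigma> * minor X (elems \<alpha>) (elems ?\<beta>) > 0"
    proof (rule pluecker_positive[of N k "\<lambda>\<alpha>. \<sigma> * minor X (elems \<alpha>) (elems ?\<beta>)", OF _ _ k \<open>\<alpha> \<in> index_sets N k\<close>])
      fix S a b c d
      assume S: "finite S" "S \<subseteq> {..<N}" "card S + 2 = k" "a < b" "b < c" "c < d" "d < N"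
        "a \<notin> S" "b \<notin> S" "c \<notin> S" "d \<notin> S"
      have "length (elems ?\<beta>) = card S + 2" using S card by simp
      note rel = pluecker_relation[OF S(1) this S(4-6,8-11), of X]
      show "\<sigma> * minor X (elems (S \<union> {a, c})) (elems ?\<beta>) * (\<sigma> * minor X (elems (S \<union> {b, d})) (elems ?\<beta>))
      = \<sigma> * minor X (elems (S \<union> {a, b})) (elems ?\<beta>) * (\<sigma> * minor X (elems (S \<union> {c, d})) (elems ?\<beta>))
        + \<sigma> * minor X (elems (S \<union> {a, d})) (elems ?\<beta>) * (\<sigma> * minor X (elems (S \<union> {b, c})) (elems ?\<beta>))"
        by (rule scale[OF rel])
    qed (rule initial[OF _ _ q])
  qed
qed

lemma elems_set: "sorted_wrt (<) L \<Longrightarrow> elems (set L) = L"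
  by (rule elems_eq_iff) auto

lemma sorted_del:
  assumes "sorted_wrt (<) L" and "j < length L"
  shows "sorted_wrt (<) (del j L)"
  using assms by (auto simp: sorted_wrt_iff_nth_less nth_del)

text \<open>
  The array has in row \<open>i\<close> the single entry \<open>w i\<close>, in column \<open>b i\<close>. Since \<open>b\<close> is monotone, either
  these columns are \<open>0, \<dots>, k - 1\<close> in order and the array is diagonal, or some column vanishes.
\<close>

lemma block_minor:
  fixes w :: "nat \<Rightarrow> real"
  assumes "mono b" and L: "sorted_wrt (<) L" "length L = k" "b ` set L \<subseteq> {..<k}"
  shows "minor (\<lambda>i q. if b i = q then w i else 0) L [0..<k]
    = (if map b L = [0..<k] then \<Prod>i\<leftarrow>L. w i else 0)"
proof (cases "map b L = [0..<k]")
  case True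
  let ?A = "mat k k (\<lambda>(i, j). if b (L ! i) = [0..<k] ! j then w (L ! i) else 0)"
  have b: "b (L ! i) = i" if "i < k" for i
    using that L arg_cong[OF True, of "\<lambda>xs. xs ! i"] by simp
  have "minor (\<lambda>i q. if b i = q then w i else 0) L [0..<k] = det ?A"
    by (simp add: minor_def L)
  also have "\<dots> = prod_list (diag_mat ?A)"
    by (rule det_upper_triangular) (auto simp: b)
  also have "diag_mat ?A = map w L"
    using L b by (intro nth_equalityI) (auto simp: diag_mat_def)
  finally show ?thesis using True by simp
next
  case False
  have "\<not> {..<k} \<subseteq> b ` set L"
  proof
    assume sub: "{..<k} \<subseteq> b ` set L"
    then have "set (map b L) = {..<k}" using L by auto
    moreover from this have "distinct (map b L)" using L by (intro card_distinct) simp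
    moreover have "sorted (map b L)"
      using L \<open>mono b\<close> unfolding sorted_wrt_map
      by (elim sorted_wrt_mono_rel[rotated]) (auto intro: monoD less_imp_le)
    ultimately have "map b L = [0..<k]"
      by (intro strict_sorted_equal) (auto simp: strict_sorted_iff)
    then show False using False by simp
  qed
  then obtain q where "q < k" "q \<notin> b ` set L" by auto
  then show ?thesis using False L by (auto intro!: minor_zero_col[of q])
qed

text \<open>
  The argument of Gantmacher and Krein. Split \<open>u\<close> into \<open>k = m + 1\<close> blocks of constant sign and
  contract the columns of every block with the weights \<open>\<bar>u i\<bar>\<close>. By Cauchy-Binet the resulting
  \<open>k\<close>-column array \<open>Y\<close> again has all \<open>k\<close>-minors of the same strict sign. If its image
  \<open>Y a = X u\<close> had \<open>k + 1\<close> weakly alternating entries, the Cramer relation between these \<open>k + 1\<close> rows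
  of \<open>Y\<close>, applied to \<open>a\<close>, would be a vanishing sum of terms of one sign; so all these
  entries vanish, and then \<open>a = 0\<close> and \<open>u = 0\<close>.
\<close>

lemma S_plus_bound_if_minors_positive:
  fixes X :: "nat \<Rightarrow> nat \<Rightarrow> real" and u :: "nat \<Rightarrow> real"
  assumes minors: "\<And>\<alpha> \<beta>. finite \<alpha> \<Longrightarrow> card \<alpha> = Suc m \<Longrightarrow> \<beta> \<in> index_sets n (Suc m) \<Longrightarrow>
      \<sigma> * minor X (elems \<alpha>) (elems \<beta>) > 0"
    and n: "Suc m \<le> n" and nz: "\<not> (\<forall>i\<in>{..<n}. u i = 0)" and u: "S_minus {..<n} u \<le> ereal (real m)"
  shows "S_plus UNIV (\<lambda>t. \<Sum>j<n. X t j * u j) \<le> ereal (real m)"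
proof (rule ccontr)
  let ?k = "Suc m" and ?z = "\<lambda>t. \<Sum>j<n. X t j * u j"
  assume "\<not> S_plus UNIV ?z \<le> ereal (real m)"
  then obtain I where I: "sorted_wrt (<) I" "length I = m + 2" and "weakly_alternating ?z I"
    using weakly_alternating_if_S_plus by blast
  then obtain s where s: "s \<noteq> 0" "\<And>j. j < m + 2 \<Longrightarrow> s * (-1) ^ j * ?z (I ! j) \<ge> 0"
    by (auto simp: weakly_alternating_def)
  obtain b where b: "mono b" "b ` {..<n} = {..<?k}"
    and same: "\<And>i j. i < n \<Longrightarrow> j < n \<Longrightarrow> b i = b j \<Longrightarrow> u i * u j \<ge> 0"
    using S_minus_blocks[OF u nz n] by blast
  define occ where "occ q \<longleftrightarrow> (\<exists>i<n. b i = q \<and> u i \<noteq> 0)" for q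
  \<comment> \<open>On a block where u vanishes the weights |u i| would produce a zero column; weight 1 together with
      the coefficient a = 0 avoids this without changing the image.\<close>
  define w where "w i = (if occ (b i) then \<bar>u i\<bar> else 1)" for i
  define a where "a q = (if occ q then sgn (u (SOME i. i < n \<and> b i = q \<and> u i \<noteq> 0)) else 0)" for q
  have wa: "w i * a (b i) = u i" if "i < n" for i
  proof (cases "occ (b i)")
    case True
    define j where "j = (SOME j. j < n \<and> b j = b i \<and> u j \<noteq> 0)"
    have "j < n \<and> b j = b i \<and> u j \<noteq> 0"
      using True someI_ex[of "\<lambda>j. j < n \<and> b j = b i \<and> u j \<noteq> 0"] unfolding occ_def j_def by blast
    then have "u i * u j \<ge> 0" "u j \<noteq> 0" using same[OF that, of j] by auto
    then have "\<bar>u i\<bar> * sgn (u j) = u i"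
      by (auto simp: sgn_if zero_le_mult_iff)
    then show ?thesis using True by (simp add: w_def a_def j_def)
  next
    case False
    then show ?thesis using that by (auto simp: w_def a_def occ_def)
  qed
  define W where "W = (\<lambda>i q. if b i = q then w i else 0)"
  define Y where "Y = (\<lambda>t q. \<Sum>i<n. X t i * W i q)"
  have z: "?z t = (\<Sum>q<?k. Y t q * a q)" for t
  proof -
    have "(\<Sum>q<?k. Y t q * a q) = (\<Sum>i<n. \<Sum>q<?k. X t i * (W i q * a q))"
      unfolding Y_def sum_distrib_right by (subst sum.swap) (simp add: mult.assoc)
    also have "\<dots> = (\<Sum>i<n. X t i * u i)"
    proof (intro sum.cong refl)
      fix i assume "i \<in> {..<n}"
      then have "b i \<in> {..<?k}" "i < n" using b(2) by auto
      have "(\<Sum>q<?k. W i q * a q) = (\<Sum>q<?k. if b i = q then w i * a (b i) else 0)"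
        by (intro sum.cong) (auto simp: W_def)
      also have "\<dots> = u i"
        using \<open>b i \<in> {..<?k}\<close> wa[OF \<open>i < n\<close>] by (simp del: sum.lessThan_Suc)
      finally show "(\<Sum>q<?k. X t i * (W i q * a q)) = X t i * u i"
        by (simp only: sum_distrib_left[symmetric])
    qed
    finally show ?thesis by simp
  qed
  have Y_minor: "\<sigma> * minor Y J [0..<?k] > 0" if J: "sorted_wrt (<) J" "length J = ?k" for J
  proof -
    let ?f = "\<lambda>K. \<sigma> * minor X J (elems K) * minor W (elems K) [0..<?k]"
    have "minor Y J [0..<?k] = (\<Sum>K\<in>index_sets n ?k. minor X J (elems K) * minor W (elems K) [0..<?k])"
      unfolding Y_def J(2)[symmetric] by (rule cauchy_binet) simp
    then have eq: "\<sigma> * minor Y J [0..<?k] = (\<Sum>K\<in>index_sets n ?k. ?f K)"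
      by (simp only: sum_distrib_left mult.assoc)
    have XJ: "\<sigma> * minor X J (elems K) > 0" if "K \<in> index_sets n ?k" for K
      using minors[of "set J" K] that J by (simp add: elems_set distinct_card strict_sorted_iff)
    have w0: "w i \<ge> 0" for i by (simp add: w_def)
    have bm: "minor W L [0..<?k] = (if map b L = [0..<?k] then \<Prod>i\<leftarrow>L. w i else 0)"
      if "sorted_wrt (<) L" "length L = ?k" "set L \<subseteq> {..<n}" for L
      unfolding W_def by (rule block_minor[OF b(1) that(1,2)]) (use that b(2) in blast)
    have "\<forall>q\<in>{..<?k}. \<exists>i. i < n \<and> b i = q \<and> w i > 0"
    proof
      fix q assume "q \<in> {..<?k}"
      then obtain i where i: "i < n" "b i = q" using b(2) by (metis imageE lessThan_iff)
      show "\<exists>i. i < n \<and> b i = q \<and> w i > 0"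
      proof (cases "occ q")
        case True
        then obtain i' where "i' < n" "b i' = q" "u i' \<noteq> 0" by (auto simp: occ_def)
        then show ?thesis using True by (intro exI[of _ i']) (simp add: w_def)
      next
        case False
        then show ?thesis using i by (intro exI[of _ i]) (simp add: w_def)
      qed
    qed
    then obtain i where i: "\<And>q. q < ?k \<Longrightarrow> i q < n \<and> b (i q) = q \<and> w (i q) > 0"
      by (metis lessThan_iff)
    let ?L = "map i [0..<?k]"
    have strict: "i p < i q" if "p < q" "q < ?k" for p q
    proof (rule ccontr)
      assume "\<not> i p < i q"
      then have "b (i q) \<le> b (i p)" using b(1) by (intro monoD[of b]) auto
      then show False using i[of p] i[of q] that by simp
    qed
    have L: "sorted_wrt (<) ?L" "length ?L = ?k" "set ?L \<subseteq> {..<n}"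
      using strict i by (auto simp: sorted_wrt_iff_nth_less simp del: upt_Suc)
    have K: "set ?L \<in> index_sets n ?k" 
      using L by (auto simp only: index_sets_def mem_Collect_eq distinct_card strict_sorted_iff)
    have "map b ?L = [0..<?k]" by (rule nth_equalityI) (use i in \<open>auto simp del: upt_Suc\<close>)
    then have "minor W ?L [0..<?k] = (\<Prod>i\<leftarrow>?L. w i)" using bm[OF L] by (simp del: upt_Suc)
    also have "\<dots> > 0"
    proof -
      have prod_pos: "prod_list (map w L) > 0" if "\<And>x. x \<in> set L \<Longrightarrow> w x > 0" for L
        using that by (induction L) auto
      show ?thesis by (rule prod_pos) (use i in \<open>auto simp del: upt_Suc\<close>)
    qed
    finally have pos: "?f (set ?L) > 0"
      using XJ[OF K] elems_set[OF L(1)] by (simp del: upt_Suc)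
    have "(\<Sum>K\<in>index_sets n ?k. ?f K) > 0"
    proof (rule sum_pos2[of _ "set ?L" ?f, OF finite_index_sets K pos])
      fix K assume K: "K \<in> index_sets n ?k"
      have "minor W (elems K) [0..<?k] \<ge> 0"
      proof -
        have "prod_list (map w L) \<ge> 0" for L by (induction L) (simp_all add: w0)
        then show ?thesis using bm[of "elems K"] index_setsD[OF K] by (simp del: upt_Suc)
      qed
      then show "?f K \<ge> 0" using XJ[OF K] by simp
    qed
    then show ?thesis unfolding eq .
  qed
  define d where "d j = minor Y (del j I) [0..<?k]" for j
  have d: "\<sigma> * d j > 0" if "j < m + 2" for j
    unfolding d_def using that I by (intro Y_minor) (simp_all add: sorted_del)
  \<comment> \<open>The Cramer relation of the rows I of Y, paired with a; every term on the left is nonnegative.\<close>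
  have "(\<Sum>j<m + 2. (s * (-1) ^ j * ?z (I ! j)) * (\<sigma> * d j))
      = s * \<sigma> * (\<Sum>q<?k. a q * (\<Sum>j<m + 2. (-1) ^ j * Y (I ! j) q * d j))"
    unfolding z sum_distrib_left sum_distrib_right
    by (subst sum.swap) (intro sum.cong refl, simp add: ac_simps)
  also have "\<dots> = 0"
  proof -
    have "(\<Sum>j<m + 2. (-1) ^ j * Y (I ! j) q * d j) = 0" if "q < ?k" for q
      using cramer_relation[of I "[0..<?k]" q Y] that I by (simp add: d_def del: upt_Suc)
    then show ?thesis by (simp del: sum.lessThan_Suc)
  qed
  finally have sum0: "(\<Sum>j<m + 2. (s * (-1) ^ j * ?z (I ! j)) * (\<sigma> * d j)) = 0" .
  have "\<forall>j\<in>{..<m + 2}. (s * (-1) ^ j * ?z (I ! j)) * (\<sigma> * d j) = 0"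
  proof (rule iffD1[OF sum_nonneg_eq_0_iff sum0])
    fix j assume "j \<in> {..<m + 2}"
    then show "(s * (-1) ^ j * ?z (I ! j)) * (\<sigma> * d j) \<ge> 0"
      using s(2)[of j] less_imp_le[OF d[of j]] by (simp only: lessThan_iff mult_nonneg_nonneg)
  qed simp
  then have z0: "?z (I ! j) = 0" if "j < m + 2" for j
    using that s(1) d[OF that] by auto
  let ?J = "del 0 I"
  let ?M = "mat ?k ?k (\<lambda>(i, q). Y (?J ! i) q)"
  have "d 0 = det ?M"
    unfolding d_def minor_def using I by (intro arg_cong[where f = det] cong_mat) (simp_all del: upt_Suc)
  then have "det ?M \<noteq> 0" using d[of 0] by auto
  moreover have "?M *\<^sub>v vec ?k a = 0\<^sub>v ?k"
  proof (rule eq_vecI)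
    fix i assume "i < dim_vec (0\<^sub>v ?k)"
    then have i: "i < ?k" by simp
    then have "?J ! i = I ! Suc i" using I by (simp add: nth_del)
    then have "(\<Sum>q<?k. Y (?J ! i) q * a q) = 0"
      using z[of "I ! Suc i"] z0[of "Suc i"] i by simp
    then show "(?M *\<^sub>v vec ?k a) $ i = 0\<^sub>v ?k $ i"
      using i by (simp add: scalar_prod_def lessThan_atLeast0 del: sum.atLeast0_lessThan_Suc sum.lessThan_Suc sum.op_ivl_Suc)
  qed simp
  ultimately have "vec ?k a = 0\<^sub>v ?k"
    using det_0_iff_vec_prod_zero[of ?M ?k] by (metis mat_carrier vec_carrier)
  then have "a q = 0" if "q < ?k" for q
    using that by (metis index_vec index_zero_vec(1))
  then have "u i = 0" if "i < n" for i
    using wa[OF that] b(2) that by (metis imageI lessThan_iff mult_zero_right)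
  then show False using nz by simp
qed

section \<open>Bounded variation forces sign-consistent minors\<close>

lemma card_below_nth:
  assumes "finite I" and "j < card I"
  shows "card {s \<in> I. s < elems I ! j} = j"
  using card_pick_le[OF assms(2)] elems_nth_pick[OF assms] by simp

text \<open>
  The position of an element in the increasing enumeration is the number of smaller elements.
\<close>

lemma weakly_alternating_by_rank:
  assumes "finite I" and "s \<noteq> 0" and "\<And>t. t \<in> I \<Longrightarrow> s * (-1) ^ card {r \<in> I. r < t} * z t \<ge> 0"
  shows "weakly_alternating z (elems I)"
  unfolding weakly_alternating_def
proof (intro exI[of _ s] conjI allI impI)
  fix j assume "j < length (elems I)"
  then have "j < card I" "elems I ! j \<in> I" using assms(1) nth_mem[of j "elems I"] by auto
  then show "s * (-1) ^ j * z (elems I ! j) \<ge> 0"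
    using assms(3)[of "elems I ! j"] card_below_nth[OF assms(1), of j] by simp
qed (rule assms(2))

text \<open>
  The vector supported on \<open>L\<close> whose entry at \<open>L ! j\<close> is \<open>y j\<close>.
\<close>

definition spread_on :: "nat list \<Rightarrow> (nat \<Rightarrow> real) \<Rightarrow> nat \<Rightarrow> real" where
  "spread_on L y i = (\<Sum>j<length L. if L ! j = i then y j else 0)"

lemma spread_on_nth: "distinct L \<Longrightarrow> j < length L \<Longrightarrow> spread_on L y (L ! j) = y j"
  unfolding spread_on_def by (subst sum.cong[OF refl, of _ _ "\<lambda>i. if i = j then y i else 0"]) (auto simp: nth_eq_iff_index_eq)

lemma spread_on_outside: "i \<notin> set L \<Longrightarrow> spread_on L y i = 0"
  unfolding spread_on_def by (rule sum.neutral) auto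

lemma sum_spread_on:
  assumes "set L \<subseteq> {..<n}"
  shows "(\<Sum>i<n. X i * spread_on L y i) = (\<Sum>j<length L. X (L ! j) * y j)"
proof -
  have "(\<Sum>i<n. X i * spread_on L y i) = (\<Sum>j<length L. \<Sum>i<n. if L ! j = i then X i * y j else 0)"
    unfolding spread_on_def sum_distrib_left by (subst sum.swap) (intro sum.cong refl, simp)
  also have "\<dots> = (\<Sum>j<length L. X (L ! j) * y j)"
    using assms by (intro sum.cong refl) (auto dest: nth_mem)
  finally show ?thesis .
qed

locale variation_bound =
  fixes X :: "nat \<Rightarrow> nat \<Rightarrow> real" and n m :: nat
  assumes bound: "\<And>u. \<not> (\<forall>i\<in>{..<n}. u i = 0) \<Longrightarrow> S_minus {..<n} u \<le> ereal (real m) \<Longrightarrow>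
      S_plus UNIV (\<lambda>t. \<Sum>j<n. X t j * u j) \<le> ereal (real m)"
begin

lemma no_alternation:
  assumes "\<not> (\<forall>i\<in>{..<n}. u i = 0)" and "S_minus {..<n} u \<le> ereal (real m)"
    and "finite I" and "card I = m + 2" and "s \<noteq> 0"
    and "\<And>t. t \<in> I \<Longrightarrow> s * (-1) ^ card {r \<in> I. r < t} * (\<Sum>j<n. X t j * u j) \<ge> 0"
  shows False
  using S_plus_if_weakly_alternating[OF _ _ weakly_alternating_by_rank[OF assms(3,5,6)]] bound[OF assms(1,2)] assms(3,4)
  by simp

text \<open>
  Zeros may be given any sign, so \<open>m + 1\<close> zeros and one further position, on which the global sign is
  adjusted, form an alternating pattern with \<open>m + 1\<close> changes.
\<close>

lemma no_common_zeros:
  assumes u: "\<not> (\<forall>i\<in>{..<n}. u i = 0)" "S_minus {..<n} u \<le> ereal (real m)"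
    and \<alpha>: "finite \<alpha>" "card \<alpha> = Suc m" and zero: "\<And>t. t \<in> \<alpha> \<Longrightarrow> (\<Sum>j<n. X t j * u j) = 0"
  shows False
proof -
  let ?z = "\<lambda>t. \<Sum>j<n. X t j * u j"
  obtain l where l: "l \<notin> \<alpha>" using \<alpha>(1) ex_new_if_finite infinite_UNIV_nat by blast
  define e :: real where "e = (-1) ^ card {r \<in> insert l \<alpha>. r < l}"
  define s where "s = (if ?z l = 0 then 1 else e * ?z l)"
  have "e \<noteq> 0" by (simp add: e_def)
  then have s0: "s \<noteq> 0" by (simp add: s_def)
  show False
  proof (rule no_alternation[OF u, of "insert l \<alpha>" s])
    fix t assume t: "t \<in> insert l \<alpha>"
    show "s * (-1) ^ card {r \<in> insert l \<alpha>. r < t} * ?z t \<ge> 0"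
    proof (cases "t = l")
      case True
      have "s * e * ?z l \<ge> 0"
      proof (cases "?z l = 0")
        case False
        then have eq: "s * e * ?z l = (e * e) * (?z l * ?z l)" by (simp add: s_def ac_simps)
        show ?thesis unfolding eq by (rule mult_nonneg_nonneg) (rule zero_le_square)+
      qed simp
      then show ?thesis by (simp only: True e_def)
    next
      case False
      then show ?thesis using t zero[of t] by simp
    qed
  qed (use \<alpha> l s0 in auto)
qed

text \<open>
  A kernel vector of the submatrix, extended by zeros, has at most \<open>m + 1\<close> nonzero entries and hence at
  most \<open>m\<close> sign changes, but its image vanishes on \<open>\<alpha>\<close>.
\<close>

lemma minor_nonzero:
  assumes \<alpha>: "finite \<alpha>" "card \<alpha> = Suc m" and \<beta>: "\<beta> \<in> index_sets n (Suc m)"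
  shows "minor X (elems \<alpha>) (elems \<beta>) \<noteq> 0"
proof
  let ?k = "Suc m" and ?L = "elems \<beta>"
  note \<beta>' = index_setsD[OF \<beta>]
  let ?M = "mat ?k ?k (\<lambda>(i, j). X (elems \<alpha> ! i) (?L ! j))"
  assume "minor X (elems \<alpha>) ?L = 0"
  then have "det ?M = 0" using \<alpha> by (simp add: minor_def)
  then obtain v where v: "v \<in> carrier_vec ?k" "v \<noteq> 0\<^sub>v ?k" "?M *\<^sub>v v = 0\<^sub>v ?k"
    using det_0_iff_vec_prod_zero[of ?M ?k] by auto
  let ?u = "spread_on ?L (\<lambda>j. v $ j)"
  have L: "distinct ?L" "length ?L = ?k" "set ?L \<subseteq> {..<n}" using \<beta>' by auto
  show False
  proof (rule no_common_zeros[of ?u \<alpha>])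
    obtain j where j: "j < ?k" "v $ j \<noteq> 0" using v(1,2) by (metis carrier_vecD eq_vecI index_zero_vec)
    then have "?u (?L ! j) \<noteq> 0" "?L ! j \<in> {..<n}"
      using L(2) L(3)[THEN subsetD, OF nth_mem, of j] spread_on_nth[OF L(1), of j] by simp_all
    then show "\<not> (\<forall>i\<in>{..<n}. ?u i = 0)" by blast
    show "S_minus {..<n} ?u \<le> ereal (real m)"
      by (rule S_minus_small_support[of ?L]) (use L(2) spread_on_outside[of _ ?L] in auto)
    fix t assume "t \<in> \<alpha>"
    then obtain i where i: "i < ?k" "t = elems \<alpha> ! i"
      using \<alpha> by (metis in_set_conv_nth length_sorted_list_of_set set_sorted_list_of_set)
    have "(\<Sum>j<n. X t j * ?u j) = (\<Sum>j<?k. X t (?L ! j) * v $ j)"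
      using sum_spread_on[OF L(3), of "X t"] L(2) by simp
    also have "\<dots> = (?M *\<^sub>v v) $ i"
      using i v(1) by (simp add: scalar_prod_def lessThan_atLeast0 del: sum.op_ivl_Suc)
    also have "\<dots> = 0" using v(3) i by simp
    finally show "(\<Sum>j<n. X t j * ?u j) = 0" .
  qed (use \<alpha> in auto)
qed

text \<open>
  The cofactors of an additional row on top of the rows \<open>T\<close>, placed at the columns \<open>L\<close>: the image of
  this vector at \<open>t\<close> is the minor on the rows \<open>t # T\<close>, which vanishes for \<open>t\<close> in \<open>T\<close>.
\<close>

definition cofactor_vec :: "nat list \<Rightarrow> nat list \<Rightarrow> nat \<Rightarrow> real" where
  "cofactor_vec T L = spread_on L (\<lambda>j. (-1) ^ j * minor X T (del j L))"

lemma sum_cofactor_vec: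
  assumes "set L \<subseteq> {..<n}" and "length L = Suc (length T)"
  shows "(\<Sum>j<n. X t j * cofactor_vec T L j) = minor X (t # T) L"
  unfolding cofactor_vec_def sum_spread_on[OF assms(1)] minor_laplace_row[OF assms(2)]
  by (intro sum.cong refl) (simp add: ac_simps)

lemma cofactor_vec_nonzero:
  assumes "minor X (t # T) L \<noteq> 0" and "set L \<subseteq> {..<n}" and "length L = Suc (length T)"
  shows "\<not> (\<forall>i\<in>{..<n}. cofactor_vec T L i = 0)"
  using sum_cofactor_vec[OF assms(2,3), of t] assms(1) by force

text \<open>
  Let \<open>u\<close> be the cofactor vector for the rows \<open>S = I - {x, y}\<close>. Its image vanishes on \<open>S\<close> and takes at
  \<open>x\<close> and \<open>y\<close>, up to sign, the two minors in question. If these had opposite signs, the image would alternate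
  weakly on all of \<open>I\<close>.
\<close>

lemma minors_same_sign_rows:
  assumes I: "finite I" "card I = m + 2" and xy: "x \<in> I" "y \<in> I" "x < y" and \<beta>: "\<beta> \<in> index_sets n (Suc m)"
  shows "minor X (elems (I - {x})) (elems \<beta>) * minor X (elems (I - {y})) (elems \<beta>) > 0"
proof (rule ccontr)
  let ?L = "elems \<beta>" and ?S = "I - {x, y}"
  let ?F = "\<lambda>\<alpha>. minor X (elems \<alpha>) ?L"
  assume "\<not> ?F (I - {x}) * ?F (I - {y}) > 0"
  moreover have nz: "?F (I - {x}) \<noteq> 0" "?F (I - {y}) \<noteq> 0"
    by (rule minor_nonzero[OF _ _ \<beta>]; use I xy in simp)+
  ultimately have neg: "?F (I - {x}) * ?F (I - {y}) < 0"
    by (meson linorder_neqE_linordered_idom mult_eq_0_iff)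
  note \<beta>' = index_setsD[OF \<beta>]
  have S: "finite ?S" "card ?S = m" using I xy by (simp_all add: card_Diff_subset)
  have L: "set ?L \<subseteq> {..<n}" "length ?L = Suc (length (elems ?S))" using \<beta>' S by auto
  let ?u = "cofactor_vec (elems ?S) ?L"
  let ?z = "\<lambda>t. \<Sum>j<n. X t j * ?u j"
  let ?e = "\<lambda>t. card {s \<in> ?S. s < t}"
  have filter_card: "length (filter (\<lambda>s. s < t) (elems ?S)) = ?e t" for t
  proof -
    have "{s. s < t} \<inter> set (elems ?S) = {s \<in> ?S. s < t}" using S(1) by auto
    then show ?thesis by (simp only: distinct_length_filter distinct_sorted_list_of_set)
  qed
  have z: "?z t = minor X (t # elems ?S) ?L" for t
    by (rule sum_cofactor_vec[OF L])
  have zS: "?z t = (-1) ^ ?e t * ?F (insert t ?S)" if "t \<notin> ?S" for t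
    unfolding z filter_card[symmetric] by (rule minor_cons_elems) (use S L that in auto)
  have ix: "insert x ?S = I - {y}" and iy: "insert y ?S = I - {x}" using xy by auto
  have zx: "?z x = (-1) ^ ?e x * ?F (I - {y})" and zy: "?z y = (-1) ^ ?e y * ?F (I - {x})"
    using zS[of x] zS[of y] unfolding ix iy by simp_all
  have z0: "?z t = 0" if "t \<in> ?S" for t
    unfolding z using that S by (intro minor_not_distinct) simp
  have rx: "card {r \<in> I. r < x} = ?e x"
    using xy by (intro arg_cong[where f = card]) auto
  have ry: "card {r \<in> I. r < y} = Suc (?e y)"
  proof -
    have "{r \<in> I. r < y} = insert x {s \<in> ?S. s < y}" using xy by auto
    then show ?thesis using S(1) by simp
  qed
  show False
  proof (rule no_alternation[of ?u I "?F (I - {y})"])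
    show "\<not> (\<forall>i\<in>{..<n}. ?u i = 0)"
      using cofactor_vec_nonzero[of x "elems ?S" ?L] L zx z[of x] nz by simp
    show "S_minus {..<n} ?u \<le> ereal (real m)"
      unfolding cofactor_vec_def
      by (rule S_minus_small_support[of ?L]) (use \<beta>' spread_on_outside[of _ ?L] in auto)
    fix t assume "t \<in> I"
    then consider "t = x" | "t = y" | "t \<in> ?S" by blast
    then show "?F (I - {y}) * (-1) ^ card {r \<in> I. r < t} * ?z t \<ge> 0"
    proof cases
      case 1
      have eq: "?F (I - {y}) * (-1) ^ ?e x * ((-1) ^ ?e x * ?F (I - {y})) = ?F (I - {y}) * ?F (I - {y})"
        by (simp add: power_mult_distrib[symmetric] mult.assoc mult.left_commute)
      show ?thesis unfolding 1 rx zx eq by (rule zero_le_square)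
    next
      case 2
      have "?F (I - {y}) * (-1) ^ Suc (?e y) * ((-1) ^ ?e y * ?F (I - {x})) = - (?F (I - {x}) * ?F (I - {y}))"
        by (simp add: power_mult_distrib[symmetric] mult.assoc mult.left_commute)
      then show ?thesis unfolding 2 ry zy using neg by linarith
    next
      case 3
      then show ?thesis by (simp only: z0)
    qed
  qed (use I nz in auto)
qed

text \<open>
  The cofactor vector of the \<open>m + 2\<close> columns \<open>B\<close> is mapped to a sequence with \<open>m + 1\<close> zeros on \<open>\<alpha>\<close>, so it must
  itself have more than \<open>m\<close> sign changes. Thus its entries, which are the minors with alternating signs, alternate
  strictly, that is, the minors all have the same sign.
\<close>

lemma minors_same_sign_cols:
  assumes \<alpha>: "finite \<alpha>" "card \<alpha> = Suc m" and B: "B \<in> index_sets n (m + 2)" and xy: "x \<in> B" "y \<in> B"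
  shows "minor X (elems \<alpha>) (elems (B - {x})) * minor X (elems \<alpha>) (elems (B - {y})) > 0"
proof -
  let ?L = "elems B" and ?T = "elems \<alpha>"
  note B' = index_setsD[OF B]
  have L: "set ?L \<subseteq> {..<n}" "length ?L = Suc (length ?T)" "sorted_wrt (<) ?L" "distinct ?L"
    using B' \<alpha> by auto
  have len: "length ?L = m + 2" using B' by simp
  let ?u = "cofactor_vec ?T ?L"
  let ?F = "\<lambda>x. minor X ?T (elems (B - {x}))"
  have del: "del j ?L = elems (B - {?L ! j})" if "j < m + 2" for j
  proof (rule elems_eq_iff[symmetric])
    have "?L = take j ?L @ ?L ! j # drop (Suc j) ?L" using that len by (simp add: id_take_nth_drop)
    then have "distinct (take j ?L @ ?L ! j # drop (Suc j) ?L)" "B = set (take j ?L @ ?L ! j # drop (Suc j) ?L)"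
      using L(4) B' by (metis, metis set_sorted_list_of_set)
    then show "set (del j ?L) = B - {?L ! j}" unfolding del_def by auto
  qed (use B' L len that in \<open>auto intro: sorted_del\<close>)
  have u: "?u (?L ! j) = (-1) ^ j * ?F (?L ! j)" if "j < m + 2" for j
    using that len L(4) by (simp add: cofactor_vec_def spread_on_nth del)
  have F_nz: "?F x \<noteq> 0" if "x \<in> B" for x
    using that B' by (intro minor_nonzero \<alpha>) (auto simp: index_sets_def)
  have nth: "\<exists>j<m + 2. x = ?L ! j" if "x \<in> B" for x
    using that B' len by (metis in_set_conv_nth set_sorted_list_of_set)
  have u_nz: "?u x \<noteq> 0" if "x \<in> B" for x
    using nth[OF that] u F_nz[OF that] by auto
  have supp: "{i \<in> {..<n}. ?u i \<noteq> 0} = set ?L"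
    using L(1) u_nz B' spread_on_outside[of _ ?L] by (auto simp: cofactor_vec_def)
  have "\<not> (\<forall>i\<in>{..<n}. ?u i = 0)" using supp xy B' by auto
  moreover have "(\<Sum>j<n. X t j * ?u j) = 0" if "t \<in> \<alpha>" for t
    unfolding sum_cofactor_vec[OF L(1,2)] using that \<alpha> by (intro minor_not_distinct) simp
  ultimately have S: "\<not> S_minus {..<n} ?u \<le> ereal (real m)"
    using no_common_zeros[OF _ _ \<alpha>] by blast
  have pos: "?u (?L ! 0) * ?F x > 0" if x: "x \<in> B" for x
  proof -
    obtain j where j: "j < m + 2" "x = ?L ! j" using nth[OF x] by blast
    have "?u (?L ! 0) * (-1) ^ j * ?u (?L ! j) > 0"
      by (rule alternating_if_S_minus[OF L(3) supp len S j(1)])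
    also have "?u (?L ! 0) * (-1) ^ j * ?u (?L ! j) = ?u (?L ! 0) * ?F x"
      unfolding u[OF j(1)] j(2) by (simp add: power_mult_distrib[symmetric] mult.assoc mult.left_commute)
    finally show ?thesis .
  qed
  show ?thesis
    using pos[OF xy(1)] pos[OF xy(2)] by (rule mult_sign_trans(1))
qed

end

text \<open>
  Any two \<open>k\<close>-sets are joined by a chain of exchanges of single elements, and two consecutive sets of the chain
  arise from a common \<open>(k + 1)\<close>-set by deleting one element.
\<close>

lemma same_sign_by_exchange:
  fixes f :: "nat set \<Rightarrow> real" and U :: "nat set"
  assumes exchange: "\<And>I x y. finite I \<Longrightarrow> I \<subseteq> U \<Longrightarrow> card I = Suc k \<Longrightarrow> x \<in> I \<Longrightarrow> y \<in> I \<Longrightarrow> x \<noteq> y \<Longrightarrow> f (I - {x}) * f (I - {y}) > 0"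
    and nz: "\<And>\<alpha>. finite \<alpha> \<Longrightarrow> \<alpha> \<subseteq> U \<Longrightarrow> card \<alpha> = k \<Longrightarrow> f \<alpha> \<noteq> 0"
    and "finite \<alpha>" "\<alpha> \<subseteq> U" "card \<alpha> = k" and \<alpha>': "finite \<alpha>'" "\<alpha>' \<subseteq> U" "card \<alpha>' = k"
  shows "f \<alpha> * f \<alpha>' > 0"
  using assms(3-5)
proof (induction "card (\<alpha> - \<alpha>')" arbitrary: \<alpha>)
  case 0
  then have "\<alpha> \<subseteq> \<alpha>'" by simp
  then have "\<alpha> = \<alpha>'" using \<alpha>' 0 by (intro card_subset_eq) auto
  then show ?case using nz[OF \<alpha>'] by (metis not_real_square_gt_zero)
next
  case (Suc d)
  obtain x where x: "x \<in> \<alpha> - \<alpha>'" using Suc.hyps(2) by (metis card.empty ex_in_conv nat.distinct(1))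
  have "\<not> \<alpha>' \<subseteq> \<alpha>"
    using x Suc.prems \<alpha>' by (metis DiffD1 DiffD2 card_subset_eq)
  then obtain y where y: "y \<in> \<alpha>' - \<alpha>" by auto
  let ?I = "insert y \<alpha>" and ?\<gamma> = "insert y \<alpha> - {x}"
  have "f (?I - {y}) * f (?I - {x}) > 0"
    by (rule exchange) (use x y Suc.prems \<alpha>' in auto)
  then have "f ?\<gamma> * f \<alpha> > 0" using y by (simp add: mult.commute)
  moreover have "f ?\<gamma> * f \<alpha>' > 0"
  proof (rule Suc.hyps(1))
    have "?\<gamma> - \<alpha>' = (\<alpha> - \<alpha>') - {x}" using y by auto
    then show "d = card (?\<gamma> - \<alpha>')" using Suc.hyps(2) x Suc.prems by simp
  qed (use x y Suc.prems \<alpha>' in auto)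
  ultimately show ?case by (rule mult_sign_trans(1))
qed

lemma (in variation_bound) minors_same_sign:
  assumes "finite \<alpha>" "card \<alpha> = Suc m" "\<beta> \<in> index_sets n (Suc m)"
    and "finite \<alpha>'" "card \<alpha>' = Suc m" "\<beta>' \<in> index_sets n (Suc m)"
  shows "minor X (elems \<alpha>) (elems \<beta>) * minor X (elems \<alpha>') (elems \<beta>') > 0"
proof -
  have "minor X (elems \<alpha>) (elems \<beta>) * minor X (elems \<alpha>') (elems \<beta>) > 0"
  proof (rule same_sign_by_exchange[where U = UNIV and k = "Suc m"])
    fix I and x y :: nat assume I: "finite I" "card I = Suc (Suc m)" "x \<in> I" "y \<in> I" "x \<noteq> y"
    then show "minor X (elems (I - {x})) (elems \<beta>) * minor X (elems (I - {y})) (elems \<beta>) > 0"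
      using minors_same_sign_rows[of I x y \<beta>] minors_same_sign_rows[of I y x \<beta>] assms(3)
      by (cases x y rule: linorder_cases) (simp_all add: mult.commute)
  qed (use assms minor_nonzero in auto)
  moreover have "minor X (elems \<alpha>') (elems \<beta>) * minor X (elems \<alpha>') (elems \<beta>') > 0"
  proof (rule same_sign_by_exchange[where U = "{..<n}" and k = "Suc m"])
    fix I and x y :: nat assume "finite I" "I \<subseteq> {..<n}" "card I = Suc (Suc m)" "x \<in> I" "y \<in> I" "x \<noteq> y"
    then show "minor X (elems \<alpha>') (elems (I - {x})) * minor X (elems \<alpha>') (elems (I - {y})) > 0"
      by (intro minors_same_sign_cols assms) (auto simp: index_sets_def)
  next
    fix \<beta> assume "finite \<beta>" "\<beta> \<subseteq> {..<n}" "card \<beta> = Suc m"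
    then show "minor X (elems \<alpha>') (elems \<beta>) \<noteq> 0"
      by (intro minor_nonzero assms) (auto simp: index_sets_def)
  qed (use index_setsD[OF assms(3)] index_setsD[OF assms(6)] in auto)
  ultimately show ?thesis by (rule mult_sign_trans(2))
qed

section \<open>The observability operator and its compound systems\<close>

context observable_pair
begin

lemma obs_op_sum:
  assumes "x \<in> carrier_vec n"
  shows "obs_op A c x t = (\<Sum>j<n. output_coeff t j * x $ j)"
proof -
  have "(R *\<^sub>v x) $ 0 = (\<Sum>j<n. R $$ (0, j) * x $ j)" if "R \<in> carrier_mat 1 n" for R :: "real mat"
    using that assms by (auto simp: scalar_prod_def lessThan_atLeast0)
  from this[OF row_carrier] show ?thesis
    by (simp only: obs_op_def output_coeff_def)
qed

lemma strictly_variation_bounding_iff: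
  "strictly_variation_bounding m n (obs_op A c) \<longleftrightarrow> variation_bound output_coeff n m"
proof
  assume l: "strictly_variation_bounding m n (obs_op A c)"
  show "variation_bound output_coeff n m"
  proof
    fix u :: "nat \<Rightarrow> real" assume u: "\<not> (\<forall>i\<in>{..<n}. u i = 0)" "S_minus {..<n} u \<le> ereal (real m)"
    have "S_minus {..<n} (\<lambda>i. vec n u $ i) = S_minus {..<n} u"
    proof -
      let ?D = "{i \<in> {..<n}. u i \<noteq> 0}"
      have "{i \<in> {..<n}. vec n u $ i \<noteq> 0} = ?D" by auto
      moreover have "(\<forall>i\<in>{..<n}. vec n u $ i = 0) \<longleftrightarrow> (\<forall>i\<in>{..<n}. u i = 0)" by auto
      moreover have "sign_change_pairs ?D (\<lambda>i. vec n u $ i) = sign_change_pairs ?D u"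
        by (auto simp: sign_change_pairs_def)
      ultimately show ?thesis by (simp only: S_minus_def sign_changes_def)
    qed
    moreover have "vec n u \<noteq> 0\<^sub>v n"
      using u(1) by (metis index_vec index_zero_vec(1) lessThan_iff)
    ultimately have "S_plus UNIV (obs_op A c (vec n u)) \<le> ereal (real m)"
      using l u(2) unfolding strictly_variation_bounding_def by auto
    moreover have "obs_op A c (vec n u) = (\<lambda>t. \<Sum>j<n. output_coeff t j * u j)"
      by (rule ext) (simp add: obs_op_sum)
    ultimately show "S_plus UNIV (\<lambda>t. \<Sum>j<n. output_coeff t j * u j) \<le> ereal (real m)" by simp
  qed
next
  assume r: "variation_bound output_coeff n m"
  show "strictly_variation_bounding m n (obs_op A c)"
    unfolding strictly_variation_bounding_def
  proof (intro ballI impI)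
    fix u :: "real vec" assume u: "u \<in> carrier_vec n" "u \<noteq> 0\<^sub>v n \<and> S_minus {..<n} (\<lambda>i. u $ i) \<le> ereal (real m)"
    have "\<not> (\<forall>i\<in>{..<n}. u $ i = 0)"
      using u by (auto intro!: eq_vecI)
    then have "S_plus UNIV (\<lambda>t. \<Sum>j<n. output_coeff t j * u $ j) \<le> ereal (real m)"
      using variation_bound.bound[OF r] u(2) by blast
    moreover have "obs_op A c u = (\<lambda>t. \<Sum>j<n. output_coeff t j * u $ j)"
      by (rule ext) (rule obs_op_sum[OF u(1)])
    ultimately show "S_plus UNIV (obs_op A c u) \<le> ereal (real m)" by simp
  qed
qed

definition initial_minor :: "nat \<Rightarrow> nat \<Rightarrow> nat \<Rightarrow> nat \<Rightarrow> nat \<Rightarrow> real" where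
  "initial_minor k p s q s' = minor output_coeff
     (elems ({..<p} \<union> {s..<s + (k - p)})) (elems ({..<q} \<union> {s'..<s' + (k - q)}))"

text \<open>
  The set \<open>R\<close> consists of the parameters of all pairs of initial index sets. One direction uses that the sign
  common to all minors is the sign of the leading one, the other that the sign of the initial
  minors determines the sign of all minors.
\<close>

lemma strictly_variation_bounding_iff_initial_minors:
  assumes "Suc m \<le> n"
  defines "k \<equiv> Suc m"
  defines "R \<equiv> {(p, s, q, s'). p < k \<and> p \<le> s \<and> q < k \<and> q \<le> s' \<and> s' + (k - q) \<le> n}"
  shows "strictly_variation_bounding m n (obs_op A c) \<longleftrightarrow>
    (\<forall>(p, s, q, s')\<in>R. initial_minor k p s q s' > 0) \<or> (\<forall>(p, s, q, s')\<in>R. initial_minor k p s q s' < 0)"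
proof -
  have sets: "finite ({..<p} \<union> {s..<s + (k - p)})" "card ({..<p} \<union> {s..<s + (k - p)}) = k"
    "{..<q} \<union> {s'..<s' + (k - q)} \<in> index_sets n k" if "(p, s, q, s') \<in> R" for p s q s'
    using that index_setsD[OF initial_index_set[of p k s "s + (k - p)"]] initial_index_set[of q k s' n]
    by (auto simp: R_def)
  have bound: "variation_bound output_coeff n m"
    if pos: "\<And>p s q s'. (p, s, q, s') \<in> R \<Longrightarrow> \<sigma> * initial_minor k p s q s' > 0" for \<sigma>
  proof
    fix u :: "nat \<Rightarrow> real" assume u: "\<not> (\<forall>i\<in>{..<n}. u i = 0)" "S_minus {..<n} u \<le> ereal (real m)"
    show "S_plus UNIV (\<lambda>t. \<Sum>j<n. output_coeff t j * u j) \<le> ereal (real m)"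
    proof (rule S_plus_bound_if_minors_positive[OF _ assms(1) u])
      fix \<alpha> \<beta> :: "nat set" assume \<alpha>\<beta>: "finite \<alpha>" "card \<alpha> = Suc m" "\<beta> \<in> index_sets n (Suc m)"
      show "\<sigma> * minor output_coeff (elems \<alpha>) (elems \<beta>) > 0"
      proof (rule all_minors_positive[where k = k and n = n])
        fix p s q s' assume "p < k" "p \<le> s" "q < k" "q \<le> s'" "s' + (k - q) \<le> n"
        then have "(p, s, q, s') \<in> R" unfolding R_def by blast
        from pos[OF this]
        show "\<sigma> * minor output_coeff (elems ({..<p} \<union> {s..<s + (k - p)})) (elems ({..<q} \<union> {s'..<s' + (k - q)})) > 0"
          unfolding initial_minor_def .
      qed (use \<alpha>\<beta> in \<open>simp_all add: k_def\<close>)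
    qed
  qed
  show ?thesis
    unfolding strictly_variation_bounding_iff
  proof (intro iffI)
    assume "variation_bound output_coeff n m"
    then interpret variation_bound output_coeff n m .
    define f0 where "f0 = minor output_coeff (elems {..<k}) (elems {..<k})"
    have "f0 * initial_minor k p s q s' > 0" if "(p, s, q, s') \<in> R" for p s q s'
      unfolding f0_def initial_minor_def
      by (rule minors_same_sign) (use sets[OF that] assms(1) in \<open>auto simp: k_def index_sets_def\<close>)
    then show "(\<forall>(p, s, q, s')\<in>R. initial_minor k p s q s' > 0) \<or> (\<forall>(p, s, q, s')\<in>R. initial_minor k p s q s' < 0)"
      by (cases "f0 > 0") (auto simp: zero_less_mult_iff)
  next
    assume "(\<forall>(p, s, q, s')\<in>R. initial_minor k p s q s' > 0) \<or> (\<forall>(p, s, q, s')\<in>R. initial_minor k p s q s' < 0)"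
    then show "variation_bound output_coeff n m"
    proof
      assume "\<forall>(p, s, q, s')\<in>R. initial_minor k p s q s' > 0"
      then show ?thesis by (intro bound[of 1]) auto
    next
      assume "\<forall>(p, s, q, s')\<in>R. initial_minor k p s q s' < 0"
      then show ?thesis by (intro bound[of "-1"]) auto
    qed
  qed
qed

lemma system_output_initial_minor:
  assumes "r \<in> {1..k}" and "r' \<in> {1..k}" and "t' \<in> {k - r' + 1..n - r' + 1}" and "k \<le> n" and "1 \<le> t"
  shows "(c_tilde A c r * A_tilde A r ^\<^sub>m (t - 1) * b_tilde A c k r ({..<k - r'} \<union> {t' - 1..<t' + r' - 1})) $$ (0, 0)
    = initial_minor k (k - r) (k - r + (t - 1)) (k - r') (t' - 1)"
proof -
  let ?\<beta> = "{..<k - r'} \<union> {t' - 1..<t' + r' - 1}"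
  have \<beta>_eq: "?\<beta> = {..<k - r'} \<union> {t' - 1..<t' - 1 + (k - (k - r'))}" using assms by auto
  have \<beta>: "?\<beta> \<in> index_sets n k"
    unfolding \<beta>_eq by (rule initial_index_set) (use assms in auto)
  have kr: "k - r + r = k" "k - (k - r) = r" using assms by auto
  show ?thesis
    unfolding initial_minor_def \<beta>_eq[symmetric] kr elems_initial[OF le_add1]
    by (rule compound_system_output[of ?\<beta> "k - r" r "t - 1", unfolded kr, OF \<beta>]) (use assms in auto)
qed

text \<open>
  The parameters \<open>r, t\<close> of a system and \<open>r', t'\<close> of its input vector run through all initial row and column sets:
  \<open>p = k - r\<close>, \<open>s = k - r + t - 1\<close>, \<open>q = k - r'\<close>, \<open>s' = t' - 1\<close>.
\<close>

lemma systems_iff_initial_minors: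
  assumes "1 \<le> k" and "k \<le> n"
  defines "R \<equiv> {(p, s, q, s'). p < k \<and> p \<le> s \<and> q < k \<and> q \<le> s' \<and> s' + (k - q) \<le> n}"
  shows "(\<forall>r \<in> {1..k}. \<forall>r' \<in> {1..k}. \<forall>t' \<in> {k - r' + 1..n - r' + 1}. \<forall>t\<ge>1.
      P ((c_tilde A c r * A_tilde A r ^\<^sub>m (t - 1) * b_tilde A c k r ({..<k - r'} \<union> {t' - 1..<t' + r' - 1})) $$ (0, 0)))
    \<longleftrightarrow> (\<forall>(p, s, q, s')\<in>R. P (initial_minor k p s q s'))" (is "?l \<longleftrightarrow> ?r")
proof
  assume l: ?l
  show ?r
  proof (clarify)
    fix p s q s' assume "(p, s, q, s') \<in> R"
    then have R: "p < k" "p \<le> s" "q < k" "q \<le> s'" "s' + (k - q) \<le> n" by (auto simp: R_def)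
    let ?t = "s - p + 1"
    have eq: "k - (k - p) = p" "k - (k - q) = q" "p + (?t - 1) = s" "s' + 1 - 1 = s'" using R by auto
    have mem: "k - p \<in> {1..k}" "k - q \<in> {1..k}" "s' + 1 \<in> {k - (k - q) + 1..n - (k - q) + 1}" "1 \<le> ?t" using R by auto
    from l[THEN bspec, OF mem(1), THEN bspec, OF mem(2), THEN bspec, OF mem(3), THEN spec, THEN mp, OF mem(4)]
    show "P (initial_minor k p s q s')"
      unfolding system_output_initial_minor[OF mem(1-3) assms(2) mem(4)] unfolding eq .
  qed
next
  assume r: ?r
  show ?l
  proof (intro ballI allI impI)
    fix r r' t' t :: nat assume h: "r \<in> {1..k}" "r' \<in> {1..k}" "t' \<in> {k - r' + 1..n - r' + 1}" "1 \<le> t"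
    then have "(k - r, k - r + (t - 1), k - r', t' - 1) \<in> R" using assms by (auto simp: R_def)
    then show "P ((c_tilde A c r * A_tilde A r ^\<^sub>m (t - 1) * b_tilde A c k r ({..<k - r'} \<union> {t' - 1..<t' + r' - 1})) $$ (0, 0))"
      using r unfolding system_output_initial_minor[OF h(1-3) assms(2) h(4)] by blast
  qed
qed

end

theorem theorem2:
  fixes A c :: "real mat" and n k :: nat
  assumes "A \<in> carrier_mat n n" and "c \<in> carrier_mat 1 n"
    and "observable A c"
    and "k \<in> {1..n}"
  shows
    "(\<forall>r \<in> {1..k}. \<forall>\<beta> \<in> index_sets n k. \<forall>N t.
        1 \<le> N \<and> 1 \<le> t \<and> t + k \<le> N + 1 \<longrightarrow>
          det (submatrix (obs_mat A c N) ({..<k - r} \<union> {k - r + t - 1..<k + t - 1}) \<beta>)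
            = (c_tilde A c r * A_tilde A r ^\<^sub>m (t - 1) * b_tilde A c k r \<beta>) $$ (0, 0))
     \<and>
     (strictly_variation_bounding (k - 1) n (obs_op A c) \<longleftrightarrow>
        (\<forall>r \<in> {1..k}. \<forall>r' \<in> {1..k}. \<forall>t' \<in> {k - r' + 1..n - r' + 1}.
           strictly_externally_positive (A_tilde A r)
             (b_tilde A c k r ({..<k - r'} \<union> {t' - 1..<t' + r' - 1})) (c_tilde A c r))
        \<or>
        (\<forall>r \<in> {1..k}. \<forall>r' \<in> {1..k}. \<forall>t' \<in> {k - r' + 1..n - r' + 1}.
           strictly_externally_negative (A_tilde A r)
             (b_tilde A c k r ({..<k - r'} \<union> {t' - 1..<t' + r' - 1})) (c_tilde A c r)))"
proof (rule conjI)
  interpret observable_pair A c n using assms by unfold_locales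
  show "\<forall>r \<in> {1..k}. \<forall>\<beta> \<in> index_sets n k. \<forall>N t.
        1 \<le> N \<and> 1 \<le> t \<and> t + k \<le> N + 1 \<longrightarrow>
          det (submatrix (obs_mat A c N) ({..<k - r} \<union> {k - r + t - 1..<k + t - 1}) \<beta>)
            = (c_tilde A c r * A_tilde A r ^\<^sub>m (t - 1) * b_tilde A c k r \<beta>) $$ (0, 0)"
  proof (intro ballI allI impI)
    fix r \<beta> N t assume r: "r \<in> {1..k}" and \<beta>: "\<beta> \<in> index_sets n k" and t: "1 \<le> N \<and> 1 \<le> t \<and> t + k \<le> N + 1"
    let ?s = "k - r + (t - 1)"
    have kr: "k - r + r = k" "k - (k - r) = r" using r by auto
    have \<alpha>: "{..<k - r} \<union> {k - r + t - 1..<k + t - 1} = {..<k - r} \<union> {?s..<?s + r}"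
      using r t by auto
    have "{..<k - r} \<union> {?s..<?s + (k - (k - r))} \<in> index_sets N k"
      by (rule initial_index_set) (use r t in auto)
    then have "{..<k - r} \<union> {?s..<?s + r} \<in> index_sets N k" unfolding kr .
    from det_obs_submatrix[OF this \<beta>] compound_system_output[of \<beta> "k - r" r "t - 1", unfolded kr, OF \<beta>]
    show "det (submatrix (obs_mat A c N) ({..<k - r} \<union> {k - r + t - 1..<k + t - 1}) \<beta>)
            = (c_tilde A c r * A_tilde A r ^\<^sub>m (t - 1) * b_tilde A c k r \<beta>) $$ (0, 0)"
      unfolding \<alpha> elems_initial[OF le_add1] using r assms(4) by simp
  qed
  have k: "1 \<le> k" "k \<le> n" and Suc: "Suc (k - 1) = k" using assms(4) by auto
  show "strictly_variation_bounding (k - 1) n (obs_op A c) \<longleftrightarrow>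
        (\<forall>r \<in> {1..k}. \<forall>r' \<in> {1..k}. \<forall>t' \<in> {k - r' + 1..n - r' + 1}.
           strictly_externally_positive (A_tilde A r)
             (b_tilde A c k r ({..<k - r'} \<union> {t' - 1..<t' + r' - 1})) (c_tilde A c r))
        \<or>
        (\<forall>r \<in> {1..k}. \<forall>r' \<in> {1..k}. \<forall>t' \<in> {k - r' + 1..n - r' + 1}.
           strictly_externally_negative (A_tilde A r)
             (b_tilde A c k r ({..<k - r'} \<union> {t' - 1..<t' + r' - 1})) (c_tilde A c r))"
    unfolding strictly_externally_positive_def strictly_externally_negative_def
      systems_iff_initial_minors[OF k, of "\<lambda>x. x > 0"] systems_iff_initial_minors[OF k, of "\<lambda>x. x < 0"]
    using strictly_variation_bounding_iff_initial_minors[of "k - 1"] k unfolding Suc by blast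
qed

end
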